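(* Let $(\Sigma)$: $\dot g=\mathcal X(g)+\sum_{j=1}^m u_jB_j(g)$ be a linear system on the generalized Heisenberg group $\mathbb{H}^n$, and let $Z$ be a generator of the center of $\mathfrak h^n$. If $(\Sigma)$ satisfies the rank condition and if $Z$ belongs to the Lie algebra generated by $B_1,\dots,B_m$, then $(\Sigma)$ is controllable in exact time $T$ for all $T>0$.
   Context: $\mathbb{H}^n$ is the $(2n+1)$-dimensional simply connected Lie group of real $(n+2)\times(n+2)$ upper triangular matrices with ones on the diagonal, first row $(1,y_1,\dots,y_n,z)$, last column $(z,x_1,\dots,x_n,1)^T$, and all other off-diagonal entries $0$. Its Lie algebra $\mathfrak h^n$ (the right-invariant vector fields) has basis $X_i=\partial/\partial x_i$, $Y_i=\partial/\partial y_i+x_i\,\partial/\partial z$ $(1\le i\le n)$, $Z=\partial/\partial z$, with $[X_i,Y_i]=Z$ and all other brackets zero; its center is $\mathbb RZ$, equal to the derived algebra. A vector field $\mathcal X$ on a connected Lie group $G$ is linear if its flow is a one-parameter group of automorphisms of $G$; the associated derivation of the Lie algebra $\mathfrak g$ (of right-invariant vector fields) is $D=-\mathrm{ad}(\mathcal X)$. A linear system is a control system $\dot g=\mathcal X(g)+\sum_{j=1}^m u_jB_j(g)$ with $\mathcal X$ linear, the $B_j$ right-invariant, and inputs $u=(u_1,\dots,u_m)$ measurable, locally bounded, with values in $\mathbb R^m$. It is controllable in exact time $T$ if for all $g,h\in G$ some input steers $g$ to $h$ in time exactly $T$. Rank condition: the Lie subalgebra of $\mathfrak g$ generated by $\{D^kB_j:\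 k\in\mathbb N,\ 1\le j\le m\}$ is equal to $\mathfrak g$. *)

theory Defs
  imports "HOL-Analysis.Analysis"
begin

section \<open>The generalized Heisenberg group\<close>

text \<open>A group element is given by its global coordinates \<open>(x, y, z)\<close>; \<open>heis_matrix\<close> below
  is the corresponding unipotent matrix, whose rows and columns are indexed by
  \<open>first, 1, \<dots>, n, last\<close>, with \<open>n\<close> the cardinality of \<open>'n\<close>.\<close>

type_synonym 'n heis = "(real^'n) \<times> (real^'n) \<times> real"

type_synonym 'n heis_index = "unit + 'n + unit"

fun heis_mult :: "'n::finite heis \<Rightarrow> 'n heis \<Rightarrow> 'n heis" where
  "heis_mult (x, y, z) (x', y', z') = (x + x', y + y', z + z' + y \<bullet> x')"

fun heis_entry :: "'n::finite heis \<Rightarrow> 'n heis_index \<Rightarrow> 'n heis_index \<Rightarrow> real" where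
  "heis_entry (x, y, z) (Inl _) (Inr (Inl k)) = y $ k"
| "heis_entry (x, y, z) (Inl _) (Inr (Inr _)) = z"
| "heis_entry (x, y, z) (Inr (Inl k)) (Inr (Inr _)) = x $ k"
| "heis_entry _ i j = (if i = j then 1 else 0)"

definition heis_matrix :: "'n::finite heis \<Rightarrow> real^('n heis_index)^('n heis_index)" where
  "heis_matrix g = (\<chi> i j. heis_entry g i j)"

lemma sum_heis_index:
  fixes f :: "'n::finite heis_index \<Rightarrow> real"
  shows "(\<Sum>i\<in>UNIV. f i) = f (Inl ()) + (\<Sum>k\<in>UNIV. f (Inr (Inl k))) + f (Inr (Inr ()))"
  by (simp add: UNIV_Plus_UNIV[symmetric] sum.Plus comp_def UNIV_unit add.assoc del: UNIV_Plus_UNIV)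

lemma heis_index_cases:
  fixes i :: "'n heis_index"
  obtains "i = Inl ()" | k where "i = Inr (Inl k)" | "i = Inr (Inr ())"
  by (metis old.unit.exhaust sum.exhaust)

lemma heis_matrix_mult: "heis_matrix (heis_mult g h) = heis_matrix g ** heis_matrix h"
proof -
  obtain x y z x' y' z' where gh: "g = (x, y, z)" "h = (x', y', z')"
    by (metis prod_cases3)
  have "heis_entry (heis_mult g h) i j = (\<Sum>k\<in>UNIV. heis_entry g i k * heis_entry h k j)" for i j
    unfolding sum_heis_index gh
    by (cases i rule: heis_index_cases; cases j rule: heis_index_cases)
       (simp_all add: inner_vec_def mult_delta_left mult_delta_right)
  then show ?thesis
    by (simp add: heis_matrix_def matrix_matrix_mult_def vec_eq_iff)
qed

lemma inj_heis_matrix: "inj (heis_matrix :: 'n::finite heis \<Rightarrow> _)"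
proof (rule injI)
  fix g h :: "'n heis"
  assume eq: "heis_matrix g = heis_matrix h"
  obtain x y z x' y' z' where gh: "g = (x, y, z)" "h = (x', y', z')"
    by (metis prod_cases3)
  have e: "heis_entry g i j = heis_entry h i j" for i j
    using eq by (simp add: heis_matrix_def vec_eq_iff)
  show "g = h"
    using e[of "Inl ()" "Inr (Inl _)"] e[of "Inl ()" "Inr (Inr ())"]
      e[of "Inr (Inl _)" "Inr (Inr ())"]
    by (simp add: gh vec_eq_iff)
qed


section \<open>Smooth maps and vector fields\<close>

primrec Ck_map :: "nat \<Rightarrow> ('a::euclidean_space \<Rightarrow> 'b::euclidean_space) \<Rightarrow> bool" where
  "Ck_map 0 f \<longleftrightarrow> continuous_on UNIV f"
| "Ck_map (Suc k) f \<longleftrightarrow> (\<forall>x. f differentiable (at x)) \<and>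
     (\<forall>v. Ck_map k (\<lambda>x. frechet_derivative f (at x) v))"

definition smooth_map :: "('a::euclidean_space \<Rightarrow> 'b::euclidean_space) \<Rightarrow> bool" where
  "smooth_map f \<longleftrightarrow> (\<forall>k. Ck_map k f)"

text \<open>The tangent bundle is trivialized by the global coordinates, so a vector field is a map
  from the group to its coordinate space.\<close>

type_synonym 'n vfield = "'n heis \<Rightarrow> 'n heis"

definition lie_bracket :: "'n::finite vfield \<Rightarrow> 'n vfield \<Rightarrow> 'n vfield" where
  "lie_bracket V W =
     (\<lambda>g. frechet_derivative W (at g) (V g) - frechet_derivative V (at g) (W g))"

definition right_invariant :: "'n::finite vfield \<Rightarrow> bool" where
  "right_invariant V \<longleftrightarrow>
     (\<forall>g h. V (heis_mult g h) = frechet_derivative (\<lambda>k. heis_mult k h) (at g) (V g))"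

definition heis_algebra :: "'n::finite vfield set" where
  "heis_algebra = {V. right_invariant V}"

definition lie_subalgebra :: "'n::finite vfield set \<Rightarrow> bool" where
  "lie_subalgebra L \<longleftrightarrow> L \<subseteq> heis_algebra \<and> (\<lambda>g. 0) \<in> L \<and>
     (\<forall>V\<in>L. \<forall>W\<in>L. (\<lambda>g. V g + W g) \<in> L) \<and>
     (\<forall>c. \<forall>V\<in>L. (\<lambda>g. c *\<^sub>R V g) \<in> L) \<and>
     (\<forall>V\<in>L. \<forall>W\<in>L. lie_bracket V W \<in> L)"

definition lie_generated :: "'n::finite vfield set \<Rightarrow> 'n vfield set" where
  "lie_generated S = lie_subalgebra hull S"

definition heis_center :: "'n::finite vfield set" where
  "heis_center = {V \<in> heis_algebra. \<forall>W\<in>heis_algebra. lie_bracket V W = (\<lambda>g. 0)}"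

definition generates_center :: "'n::finite vfield \<Rightarrow> bool" where
  "generates_center Z \<longleftrightarrow> heis_center = {\<lambda>g. c *\<^sub>R Z g | c. True}"


text \<open>Consistency of the conventions with the standard basis
  \<open>X\<^sub>i = \<partial>/\<partial>x\<^sub>i\<close>, \<open>Y\<^sub>i = \<partial>/\<partial>y\<^sub>i + x\<^sub>i \<partial>/\<partial>z\<close>, \<open>Z = \<partial>/\<partial>z\<close>.\<close>

lemma frechet_derivative_heis_mult_right:
  "frechet_derivative (\<lambda>k. heis_mult k (x, y, z)) (at g) =
     (\<lambda>(a, b, c). (a, b, c + b \<bullet> x))"
proof -
  have eq: "(\<lambda>k. heis_mult k (x, y, z)) =
      (\<lambda>k. (fst k + x, fst (snd k) + y, snd (snd k) + z + fst (snd k) \<bullet> x))"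
    by (auto simp: fun_eq_iff)
  have "((\<lambda>k. heis_mult k (x, y, z)) has_derivative (\<lambda>(a, b, c). (a, b, c + b \<bullet> x))) (at g)"
    unfolding eq by (auto intro!: derivative_eq_intros simp: case_prod_unfold)
  then show ?thesis
    by (rule frechet_derivative_at[symmetric])
qed

lemma right_invariant_iff:
  "right_invariant V \<longleftrightarrow> (\<exists>a b c. V = (\<lambda>(x, y, z). (a, b, c + b \<bullet> x)))"
proof
  assume V: "right_invariant V"
  obtain a b c where e: "V (0, 0, 0) = (a, b, c)"
    by (metis prod_cases3)
  have "V (x, y, z) = (a, b, c + b \<bullet> x)" for x y z
    using V[unfolded right_invariant_def, rule_format, of "(0, 0, 0)" "(x, y, z)"]
    by (simp add: frechet_derivative_heis_mult_right e)
  then show "\<exists>a b c. V = (\<lambda>(x, y, z). (a, b, c + b \<bullet> x))"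
    by (auto simp: fun_eq_iff)
next
  assume "\<exists>a b c. V = (\<lambda>(x, y, z). (a, b, c + b \<bullet> x))"
  then show "right_invariant V"
    by (auto simp: right_invariant_def frechet_derivative_heis_mult_right inner_add_right)
qed

lemma lie_bracket_right_invariant:
  "lie_bracket (\<lambda>(x, y, z). (a, b, c + b \<bullet> x)) (\<lambda>(x, y, z). (a', b', c' + b' \<bullet> x)) =
     (\<lambda>g. (0, 0, a \<bullet> b' - a' \<bullet> b))"
proof -
  have "((\<lambda>(x, y, z). (p, q, r + q \<bullet> x)) has_derivative (\<lambda>(u, v, w). (0, 0, q \<bullet> u))) (at g)"
    for p q :: "real^'n" and r :: real and g :: "'n heis"
    unfolding case_prod_unfold by (auto intro!: derivative_eq_intros)
  then have fd: "frechet_derivative (\<lambda>(x, y, z). (p, q, r + q \<bullet> x)) (at g) = (\<lambda>(u, v, w). (0, 0, q \<bullet> u))"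
    for p q :: "real^'n" and r :: real and g :: "'n heis"
    using frechet_derivative_at[symmetric] by blast
  show ?thesis
    unfolding lie_bracket_def fd by (auto simp: fun_eq_iff inner_commute)
qed

lemma generates_center_Z: "generates_center (\<lambda>g::'n::finite heis. (0, 0, 1))"
proof -
  have "V \<in> heis_center \<longleftrightarrow> (\<exists>c. V = (\<lambda>g. c *\<^sub>R (0, 0, 1)))" for V :: "'n vfield"
  proof
    assume V: "V \<in> heis_center"
    then obtain a b c where Veq: "V = (\<lambda>(x, y, z). (a, b, c + b \<bullet> x))"
      by (auto simp: heis_center_def heis_algebra_def right_invariant_iff)
    have 0: "a \<bullet> b' - a' \<bullet> b = 0" for a' b'
    proof -
      have "(\<lambda>(x, y, z). (a', b', 0 + b' \<bullet> x)) \<in> heis_algebra"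
        unfolding heis_algebra_def mem_Collect_eq right_invariant_iff by blast
      then have "lie_bracket V (\<lambda>(x, y, z). (a', b', 0 + b' \<bullet> x)) = (\<lambda>g. 0)"
        using V by (simp add: heis_center_def)
      then show ?thesis
        unfolding Veq lie_bracket_right_invariant by (simp add: fun_eq_iff zero_prod_def)
    qed
    have "a = 0" "b = 0"
      using 0[of a 0] 0[of 0 b] by auto
    then show "\<exists>c. V = (\<lambda>g. c *\<^sub>R (0, 0, 1))"
      by (intro exI[of _ c]) (auto simp: Veq)
  next
    assume "\<exists>c. V = (\<lambda>g. c *\<^sub>R (0, 0, 1))"
    then obtain c where V: "V = (\<lambda>(x, y, z). (0, 0, c + 0 \<bullet> x))"
      by (auto simp: fun_eq_iff)
    have "right_invariant V"
      unfolding right_invariant_iff V by blast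
    moreover have "lie_bracket V W = (\<lambda>g. 0)" if "right_invariant W" for W
      using that unfolding right_invariant_iff V
      by (auto simp: lie_bracket_right_invariant zero_prod_def simp del: inner_zero_left) simp
    ultimately show "V \<in> heis_center"
      by (simp add: heis_center_def heis_algebra_def)
  qed
  then show ?thesis
    by (auto simp: generates_center_def)
qed


section \<open>Linear systems\<close>

definition heis_automorphism :: "('n::finite heis \<Rightarrow> 'n heis) \<Rightarrow> bool" where
  "heis_automorphism f \<longleftrightarrow> bij f \<and> smooth_map f \<and> smooth_map (inv f) \<and>
     (\<forall>g h. f (heis_mult g h) = heis_mult (f g) (f h))"

definition linear_field :: "'n::finite vfield \<Rightarrow> bool" where
  "linear_field X \<longleftrightarrow> smooth_map X \<and>
     (\<exists>\<phi>. (\<forall>g. \<phi> 0 g = g) \<and>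
          (\<forall>t g. ((\<lambda>s. \<phi> s g) has_vector_derivative X (\<phi> t g)) (at t)) \<and>
          (\<forall>s t. \<phi> (s + t) = \<phi> s \<circ> \<phi> t) \<and>
          (\<forall>t. heis_automorphism (\<phi> t)))"

definition linear_system :: "'n::finite vfield \<Rightarrow> ('m::finite \<Rightarrow> 'n vfield) \<Rightarrow> bool" where
  "linear_system X B \<longleftrightarrow> linear_field X \<and> (\<forall>j. right_invariant (B j))"

definition derivation_of :: "'n::finite vfield \<Rightarrow> 'n vfield \<Rightarrow> 'n vfield" where
  "derivation_of X V = (\<lambda>g. - lie_bracket X V g)"

definition rank_condition :: "'n::finite vfield \<Rightarrow> ('m::finite \<Rightarrow> 'n vfield) \<Rightarrow> bool" where
  "rank_condition X B \<longleftrightarrow>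
     lie_generated {(derivation_of X ^^ k) (B j) | k j. True} = heis_algebra"

definition admissible_input :: "(real \<Rightarrow> real^'m::finite) \<Rightarrow> bool" where
  "admissible_input u \<longleftrightarrow> u \<in> borel_measurable lebesgue \<and> (\<forall>a b. bounded (u ` {a..b}))"

text \<open>The usual \<open>\<epsilon>\<close>-\<open>\<delta>\<close> absolute continuity on \<open>[a, b]\<close>; \<open>D\<close> ranges over the finite families of
  non-overlapping compact subintervals of \<open>[a, b]\<close>.\<close>

definition absolutely_continuous_curve :: "real \<Rightarrow> real \<Rightarrow> (real \<Rightarrow> 'a::euclidean_space) \<Rightarrow> bool"
  where "absolutely_continuous_curve a b \<gamma> \<longleftrightarrow>
    (\<forall>\<epsilon>>0. \<exists>\<delta>>0. \<forall>D. D division_of \<Union>D \<and> \<Union>D \<subseteq> {a..b} \<and> (\<Sum>I\<in>D. Sup I - Inf I) < \<delta> \<longrightarrow>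
       (\<Sum>I\<in>D. norm (\<gamma> (Sup I) - \<gamma> (Inf I))) < \<epsilon>)"

text \<open>Trajectories are Caratheodory solutions, since inputs are only measurable.\<close>

definition trajectory ::
  "'n::finite vfield \<Rightarrow> ('m::finite \<Rightarrow> 'n vfield) \<Rightarrow> (real \<Rightarrow> real^'m) \<Rightarrow> real \<Rightarrow> (real \<Rightarrow> 'n heis) \<Rightarrow> bool"
  where "trajectory X B u T \<gamma> \<longleftrightarrow> absolutely_continuous_curve 0 T \<gamma> \<and>
    (AE t in lebesgue. t \<in> {0..T} \<longrightarrow>
       (\<gamma> has_vector_derivative (X (\<gamma> t) + (\<Sum>j\<in>UNIV. u t $ j *\<^sub>R B j (\<gamma> t)))) (at t within {0..T}))"

definition controllable_in_exact_time ::
  "'n::finite vfield \<Rightarrow> ('m::finite \<Rightarrow> 'n vfield) \<Rightarrow> real \<Rightarrow> bool"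
  where "controllable_in_exact_time X B T \<longleftrightarrow>
    (\<forall>g h. \<exists>u \<gamma>. admissible_input u \<and> trajectory X B u T \<gamma> \<and> \<gamma> 0 = g \<and> \<gamma> T = h)"

end

theory Submission
  imports Defs "HOL-Library.Quadratic_Discriminant"
begin

text \<open>In logarithmic coordinates the automorphisms in the flow of \<open>X\<close> are linear maps \<open>L t\<close> that
  preserve the Lie bracket (\<open>hexp_conjugate_hom\<close>, \<open>linear_field_imp_heis_flow\<close>). A trajectory
  \<open>\<gamma> t = hexp (L t (\<eta> t))\<close> of the system is therefore the same as a curve \<open>\<eta>\<close> satisfying a driftless
  equation with control vectors \<open>L (- t) (b j)\<close>, where \<open>b j\<close> is the value of \<open>B j\<close> at the identity
  (\<open>trajectory_if_flow_coordinates\<close>). The horizontal part of \<open>\<eta>\<close> is just the integral of the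
  controlled directions, and its central part is a linear functional of the input plus the symplectic
  area swept by the horizontal part. Both endpoints are reached by explicit integrals, and continuous
  inputs suffice.

  Horizontally, the derivation \<open>- ad X\<close> acts on the algebra as the generator \<open>M\<close> of \<open>L\<close>
  (\<open>derivation_of_rfield\<close>), and the rank condition, taken modulo the center, is the Kalman condition
  for \<open>M\<close> and the \<open>b j\<close>. Hence every horizontal endpoint is reached in time \<open>T\<close> (\<open>pos_onto\<close>).

  For the central coordinate an input \<open>k\<close> that steers the horizontal part in a loop is added to such
  an input, with a factor \<open>s\<close>. The central endpoint is then a quadratic polynomial in \<open>s\<close> with
  leading coefficient half the area of the loop. If two of the \<open>B j\<close> do not commute, fast
  rotation in the two directions gives loops with area of either sign
  (\<open>loops_of_both_signs\<close>), so that every value is taken. If all \<open>B j\<close> commute, the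
  hypothesis on \<open>Z\<close> gives a constant combination of them in the center
  (\<open>center_generated_cases\<close>), which moves the central coordinate alone. The two cases are
  combined in \<open>steer\<close>.\<close>

section \<open>Exponential coordinates\<close>

text \<open>The pairing \<open>\<omega>((x, y), (x', y')) = y \<bullet> x' - x \<bullet> y'\<close> is the only structure constant of the
  algebra: in logarithmic coordinates the Lie bracket of \<open>v\<close> and \<open>w\<close>, up to the sign convention,
  is \<open>\<omega>\<close> of their horizontal parts, placed in the center.\<close>

definition symplectic :: "(real^'n) \<times> (real^'n) \<Rightarrow> (real^'n) \<times> (real^'n) \<Rightarrow> real" where
  "symplectic p q = snd p \<bullet> fst q - fst p \<bullet> snd q"

definition horiz :: "'n::finite heis \<Rightarrow> (real^'n) \<times> (real^'n)" where
  "horiz v = (fst v, fst (snd v))"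

definition vert :: "real \<Rightarrow> 'n::finite heis" where
  "vert r = (0, 0, r)"

definition brk :: "'n::finite heis \<Rightarrow> 'n heis \<Rightarrow> 'n heis" where
  "brk v w = vert (symplectic (horiz v) (horiz w))"

text \<open>The matrix exponential and its inverse. In the coordinates \<open>(x, y, z)\<close> of the group they only
  shift \<open>z\<close> by half the product \<open>y \<bullet> x\<close>, and \<open>s \<mapsto> hexp (s v)\<close> is a one-parameter group.\<close>

definition hexp :: "'n::finite heis \<Rightarrow> 'n heis" where
  "hexp = (\<lambda>(x, y, z). (x, y, z + (y \<bullet> x) / 2))"

definition hlog :: "'n::finite heis \<Rightarrow> 'n heis" where
  "hlog = (\<lambda>(x, y, z). (x, y, z - (y \<bullet> x) / 2))"

definition hexp_deriv :: "'n::finite heis \<Rightarrow> 'n heis \<Rightarrow> 'n heis" where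
  "hexp_deriv = (\<lambda>(x, y, z) (a, b, c). (a, b, c + (b \<bullet> x + y \<bullet> a) / 2))"

definition hlog_deriv :: "'n::finite heis \<Rightarrow> 'n heis \<Rightarrow> 'n heis" where
  "hlog_deriv = (\<lambda>(x, y, z) (a, b, c). (a, b, c - (b \<bullet> x + y \<bullet> a) / 2))"

lemma hexp_hlog [simp]: "hexp (hlog g) = g" and hlog_hexp [simp]: "hlog (hexp g) = g"
  by (auto simp: hexp_def hlog_def split: prod.splits)

lemma bounded_bilinear_symplectic: "bounded_bilinear (symplectic :: (real^'n::finite) \<times> (real^'n) \<Rightarrow> _)"
  unfolding bilinear_conv_bounded_bilinear[symmetric] bilinear_def
  by (auto intro!: linearI simp: symplectic_def inner_add_left inner_add_right algebra_simps)

lemma linear_horiz: "linear horiz"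
  by (rule linearI) (auto simp: horiz_def)

lemma linear_brk_left: "linear (\<lambda>v. brk v w)" and linear_brk_right: "linear (brk v)"
  by (auto intro!: linearI simp: brk_def vert_def symplectic_def horiz_def
      inner_add_left inner_add_right algebra_simps)

lemmas brk_simps = linear_add[OF linear_brk_left] linear_add[OF linear_brk_right]
  linear_scale[OF linear_brk_left] linear_scale[OF linear_brk_right]

lemma brk_self [simp]: "brk v v = 0"
  by (simp add: brk_def vert_def symplectic_def inner_commute zero_prod_def)

lemma brk_vert [simp]: "brk (vert r) v = 0" "brk v (vert r) = 0"
  by (simp_all add: brk_def vert_def symplectic_def horiz_def zero_prod_def)

lemma brk_brk [simp]: "brk (brk u v) w = 0" "brk w (brk u v) = 0"
  by (simp_all add: brk_def[of u v])

lemma brk_skew: "brk w v = - brk v w"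
  by (simp add: brk_def vert_def symplectic_def inner_commute)

text \<open>The Baker-Campbell-Hausdorff formula; it stops after the first bracket because the group
  has nilpotency class two.\<close>

lemma heis_mult_hexp:
  "heis_mult (hexp v) (hexp w) = hexp (v + w + (1/2) *\<^sub>R brk v w)"
  by (cases v; cases w)
    (auto simp: hexp_def brk_def vert_def symplectic_def horiz_def algebra_simps inner_add_left
      inner_add_right inner_commute field_simps)

lemma hexp_has_derivative: "(hexp has_derivative hexp_deriv v) (at v within S)"
proof -
  have "((\<lambda>v. (fst v, fst (snd v), snd (snd v) + (fst (snd v) \<bullet> fst v) / 2))
      has_derivative hexp_deriv v) (at v within S)"
    by (auto intro!: derivative_eq_intros simp: hexp_deriv_def case_prod_unfold add.commute)
  then show ?thesis
    by (simp add: hexp_def case_prod_unfold)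
qed

lemma hlog_has_derivative: "(hlog has_derivative hlog_deriv v) (at v within S)"
proof -
  have "((\<lambda>v. (fst v, fst (snd v), snd (snd v) - (fst (snd v) \<bullet> fst v) / 2))
      has_derivative hlog_deriv v) (at v within S)"
    by (auto intro!: derivative_eq_intros simp: hlog_deriv_def case_prod_unfold add.commute)
  then show ?thesis
    by (simp add: hlog_def case_prod_unfold)
qed

lemma hexp_deriv_hlog_deriv: "hexp_deriv v (hlog_deriv (hexp v) a) = a"
  by (cases v; cases a) (auto simp: hexp_deriv_def hlog_deriv_def hexp_def)

text \<open>An additive map has the same difference quotients at every point. Hence its derivative \<open>D\<close> at
  \<open>0\<close> is its derivative everywhere, and \<open>f - D\<close> is constant.\<close>

lemma additive_differentiable_imp_linear:
  fixes f :: "'a::real_normed_vector \<Rightarrow> 'b::real_normed_vector"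
  assumes add: "\<And>v w. f (v + w) = f v + f w" and "f differentiable (at 0)"
  shows "linear f"
proof -
  obtain D where D: "(f has_derivative D) (at 0)"
    using assms(2) by (auto simp: differentiable_def)
  have "(f has_derivative D) (at v)" for v
  proof -
    have "((\<lambda>x. x - v) has_derivative (\<lambda>h. h)) (at v)"
      by (auto intro!: derivative_eq_intros)
    then have "((\<lambda>x. f (x - v)) has_derivative D) (at v)"
      using has_derivative_compose[of "\<lambda>x. x - v" "\<lambda>h. h" v UNIV f D] D by simp
    then have "((\<lambda>x. f v + f (x - v)) has_derivative D) (at v)"
      by (auto intro!: derivative_eq_intros)
    then show ?thesis
      by (simp flip: add)
  qed
  then have "((\<lambda>v. f v - D v) has_derivative (\<lambda>h. 0)) (at v)" for v
    using has_derivative_bounded_linear[OF D]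
    by (auto intro!: derivative_eq_intros bounded_linear_imp_has_derivative)
  then obtain c where c: "f v - D v = c" for v
    using has_derivative_zero_constant[of UNIV "\<lambda>v. f v - D v"] by auto
  moreover have "f 0 = 0"
    using add[of 0 0] by simp
  ultimately have "c = 0"
    using has_derivative_bounded_linear[OF D] by (metis diff_0_right bounded_linear.linear linear_0)
  then have "f = D"
    using c by auto
  then show ?thesis
    using has_derivative_bounded_linear[OF D] bounded_linear.linear by blast
qed

text \<open>A differentiable group endomorphism is linear in logarithmic coordinates. On commuting elements the
  Baker-Campbell-Hausdorff product is addition, which gives additivity there. Comparing \<open>v w\<close> with
  \<open>w v\<close>, which differ by the central factor \<open>brk v w\<close>, shows that brackets are preserved, and then
  the correction terms in the product cancel for all \<open>v\<close> and \<open>w\<close>.\<close>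

lemma hexp_conjugate_hom:
  fixes f :: "'n::finite heis \<Rightarrow> 'n heis"
  assumes diff: "\<And>g. f differentiable (at g)"
    and hom: "\<And>g h. f (heis_mult g h) = heis_mult (f g) (f h)"
  defines "L \<equiv> \<lambda>v. hlog (f (hexp v))"
  shows "linear L" and "L (brk v w) = brk (L v) (L w)"
proof -
  have Lhom: "L (v + w + (1/2) *\<^sub>R brk v w) = L v + L w + (1/2) *\<^sub>R brk (L v) (L w)" for v w
  proof -
    have "hexp (L (v + w + (1/2) *\<^sub>R brk v w)) = f (heis_mult (hexp v) (hexp w))"
      by (simp add: L_def heis_mult_hexp)
    also have "\<dots> = heis_mult (hexp (L v)) (hexp (L w))"
      by (simp add: L_def hom)
    finally show ?thesis
      by (metis heis_mult_hexp hlog_hexp)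
  qed
  have comm: "brk (L v) (L w) = 0 \<and> L (v + w) = L v + L w" if "brk v w = 0" for v w
  proof -
    have *: "L (v + w) = L v + L w + (1/2) *\<^sub>R brk (L v) (L w)"
      using Lhom[of v w] that by simp
    have "L (w + v) = L w + L v + (1/2) *\<^sub>R brk (L w) (L v)"
      using Lhom[of w v] that brk_skew[of w v] by simp
    then have "(1/2) *\<^sub>R brk (L v) (L w) = - ((1/2) *\<^sub>R brk (L v) (L w))"
      using * brk_skew[of "L w" "L v"] by (simp add: add.commute)
    then have "(1/2) *\<^sub>R brk (L v) (L w) + (1/2) *\<^sub>R brk (L v) (L w) = 0"
      by (simp add: eq_neg_iff_add_eq_0)
    then have "brk (L v) (L w) = 0"
      by (simp flip: scaleR_left_distrib)
    then show ?thesis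
      using * by simp
  qed
  show brk: "L (brk v w) = brk (L v) (L w)" for v w
  proof -
    let ?b = "brk v w" and ?p = "w + v + (1/2) *\<^sub>R brk w v"
    have "v + w + (1/2) *\<^sub>R brk v w = ?p + ?b"
      using brk_skew[of w v] by (simp add: algebra_simps flip: scaleR_left_distrib)
    moreover have "L (?p + ?b) = L ?p + L ?b"
      using comm[of ?p ?b] by simp
    ultimately have "L v + L w + (1/2) *\<^sub>R brk (L v) (L w)
        = L w + L v + (1/2) *\<^sub>R brk (L w) (L v) + L ?b"
      using Lhom[of v w] Lhom[of w v] by metis
    then have "L ?b = (1/2) *\<^sub>R brk (L v) (L w) + (1/2) *\<^sub>R brk (L v) (L w)"
      using brk_skew[of "L w" "L v"] by (simp add: algebra_simps)
    then show ?thesis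
      by (simp flip: scaleR_left_distrib)
  qed
  have add: "L (v + w) = L v + L w" for v w
  proof -
    have "L (v + w + (1/2) *\<^sub>R brk v w) = L (v + w) + L ((1/2) *\<^sub>R brk v w)"
      using comm[of "v + w" "(1/2) *\<^sub>R brk v w"] by (simp add: brk_simps)
    moreover have "L ((1/2) *\<^sub>R brk v w) = (1/2) *\<^sub>R brk (L v) (L w)"
    proof -
      have "L v = L ((1/2) *\<^sub>R v) + L ((1/2) *\<^sub>R v)"
        using comm[of "(1/2) *\<^sub>R v" "(1/2) *\<^sub>R v"]
        by (simp add: brk_simps flip: scaleR_left_distrib)
      then have "L ((1/2) *\<^sub>R v) = (1/2) *\<^sub>R L v"
        by (simp flip: scaleR_2)
      then show ?thesis
        using brk[of "(1/2) *\<^sub>R v" w] by (simp add: brk_simps)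
    qed
    ultimately show ?thesis
      using Lhom[of v w] by simp
  qed
  obtain D where D: "(f has_derivative D) (at (hexp 0))"
    using diff[of "hexp 0"] unfolding differentiable_def by blast
  have "(L has_derivative (\<lambda>h. hlog_deriv (f (hexp 0)) (D (hexp_deriv 0 h)))) (at 0)"
    unfolding L_def
    by (rule has_derivative_compose[OF has_derivative_compose[OF hexp_has_derivative D]
          hlog_has_derivative])
  then have "L differentiable (at 0)"
    unfolding differentiable_def by blast
  then show "linear L"
    by (intro additive_differentiable_imp_linear[of L] add)
qed

text \<open>Central elements are brackets. This is how a bracket-preserving map is seen to preserve
  the center.\<close>

lemma vert_as_brk: "vert r = brk (0, axis k r, 0) (axis k 1, 0, 0)"
  by (simp add: brk_def symplectic_def horiz_def inner_axis_axis)

lemma horiz_vert [simp]: "horiz (vert r) = 0"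
  by (simp add: horiz_def vert_def zero_prod_def)

lemma horiz_brk [simp]: "horiz (brk v w) = 0"
  by (simp add: brk_def)

lemma linear_vert: "linear vert"
  by (rule linearI) (auto simp: vert_def)

section \<open>One-parameter groups of automorphisms of the Lie algebra\<close>

text \<open>\<open>L\<close> is the flow of a linear field in logarithmic coordinates and \<open>M\<close> its infinitesimal
  generator; the assumptions make \<open>M\<close> a derivation and \<open>L t\<close> the automorphism \<open>exp (t M)\<close>.\<close>

locale heis_flow =
  fixes L :: "real \<Rightarrow> 'n::finite heis \<Rightarrow> 'n heis" and M :: "'n heis \<Rightarrow> 'n heis"
  assumes L_linear: "linear (L t)"
    and L_0 [simp]: "L 0 v = v"
    and L_plus: "L (s + t) v = L s (L t v)"
    and L_brk: "L t (brk v w) = brk (L t v) (L t w)"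
    and L_deriv: "((\<lambda>s. L s v) has_vector_derivative M (L t v)) (at t)"
begin

lemma L_inverse [simp]: "L (- t) (L t v) = v" "L t (L (- t) v) = v"
  by (simp_all flip: L_plus)

lemma L_deriv_0: "((\<lambda>s. L s v) has_vector_derivative M v) (at 0)"
  using L_deriv[of v 0] by simp

lemma M_eqI: "((\<lambda>s. L s v) has_vector_derivative d) (at 0) \<Longrightarrow> M v = d"
  using L_deriv_0 vector_derivative_unique_at by blast

lemma M_linear: "linear M"
proof (rule linearI)
  show "M (v + w) = M v + M w" for v w
    by (rule M_eqI) (auto simp: linear_add[OF L_linear] intro!: derivative_eq_intros L_deriv_0)
  show "M (c *\<^sub>R v) = c *\<^sub>R M v" for c v
    by (rule M_eqI) (auto simp: linear_scale[OF L_linear] intro!: derivative_eq_intros L_deriv_0)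
qed

lemma M_L: "M (L t v) = L t (M v)"
proof (rule M_eqI)
  have "bounded_linear (L t)"
    using L_linear by (simp add: linear_conv_bounded_linear)
  from bounded_linear.has_vector_derivative[OF this L_deriv_0[of v]]
  have "((\<lambda>s. L t (L s v)) has_vector_derivative L t (M v)) (at 0)" .
  then show "((\<lambda>s. L s (L t v)) has_vector_derivative L t (M v)) (at 0)"
    by (simp add: add.commute flip: L_plus)
qed

lemma M_brk: "M (brk v w) = brk (M v) w + brk v (M w)"
proof (rule M_eqI)
  have "bounded_bilinear (brk :: 'n heis \<Rightarrow> _)"
    unfolding bilinear_conv_bounded_bilinear[symmetric] bilinear_def
    using linear_brk_left linear_brk_right by auto
  from bounded_bilinear.has_vector_derivative[OF this L_deriv_0 L_deriv_0, of v w]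
  show "((\<lambda>s. L s (brk v w)) has_vector_derivative brk (M v) w + brk v (M w)) (at 0)"
    by (simp add: L_brk add.commute)
qed

lemma horiz_L_vert [simp]: "horiz (L t (vert r)) = 0"
  by (metis vert_as_brk L_brk horiz_brk)

text \<open>The scalar by which \<open>L t\<close> acts on the center. It is a continuous character of the reals
  and hence positive, so that integrals of it over time do not vanish.\<close>

definition factor :: "real \<Rightarrow> real" where
  "factor t = snd (snd (L t (vert 1)))"

lemma L_vert: "L t (vert r) = vert (factor t * r)"
proof -
  have "L t (vert 1) = vert (factor t)"
    using horiz_L_vert[of t 1]
    by (cases "L t (vert 1)") (auto simp: factor_def vert_def horiz_def zero_prod_def)
  then show ?thesis
    using linear_scale[OF L_linear, of t r "vert 1"] by (auto simp: vert_def mult.commute)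
qed

lemma factor_plus: "factor (s + t) = factor s * factor t"
  using L_plus[of s t "vert 1"] by (simp add: L_vert) (simp add: vert_def)

lemma factor_pos: "factor t > 0"
proof -
  have "factor t * factor (- t) = factor 0"
    by (simp flip: factor_plus)
  also have "\<dots> = 1"
    by (simp add: factor_def vert_def)
  finally have "factor t \<noteq> 0"
    by auto
  moreover have "factor t = factor (t / 2) * factor (t / 2)"
    by (simp flip: factor_plus)
  ultimately show ?thesis
    by (metis mult_eq_0_iff not_real_square_gt_zero)
qed

lemma continuous_on_L: "continuous_on S (\<lambda>t. L t v)"
  by (intro continuous_at_imp_continuous_on ballI has_vector_derivative_continuous[OF L_deriv])

lemma continuous_on_factor: "continuous_on S factor"
  unfolding factor_def by (intro continuous_intros continuous_on_L)

lemma symplectic_L: "symplectic (horiz (L t v)) (horiz (L t w)) = factor t * symplectic (horiz v) (horiz w)"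
proof -
  have "brk (L t v) (L t w) = vert (factor t * symplectic (horiz v) (horiz w))"
    unfolding L_brk[symmetric] by (simp add: brk_def L_vert)
  then show ?thesis
    by (simp add: brk_def vert_def)
qed

text \<open>Variation of constants: a curve written as \<open>L t (\<eta> t)\<close> sees the drift \<open>M\<close>, plus the
  velocity of \<open>\<eta>\<close> transported by \<open>L t\<close>.\<close>

lemma L_moving_deriv:
  assumes "(\<eta> has_vector_derivative \<eta>') (at t within S)"
  shows "((\<lambda>t. L t (\<eta> t)) has_vector_derivative M (L t (\<eta> t)) + L t \<eta>') (at t within S)"
proof -
  have expand: "L t v = (\<Sum>b\<in>Basis. (v \<bullet> b) *\<^sub>R L t b)" for t v
    using euclidean_representation[of v] linear_sum[OF L_linear, of t "\<lambda>b. (v \<bullet> b) *\<^sub>R b" Basis]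
    by (simp add: linear_scale[OF L_linear])
  have Mexpand: "M (L t v) = (\<Sum>b\<in>Basis. (v \<bullet> b) *\<^sub>R M (L t b))" for v
    using arg_cong[OF expand[of t v], of M]
    by (simp add: linear_sum[OF M_linear] linear_scale[OF M_linear])
  have "((\<lambda>t. \<Sum>b\<in>Basis. (\<eta> t \<bullet> b) *\<^sub>R L t b) has_vector_derivative
      (\<Sum>b\<in>Basis. (\<eta> t \<bullet> b) *\<^sub>R M (L t b) + (\<eta>' \<bullet> b) *\<^sub>R L t b)) (at t within S)"
    by (intro has_vector_derivative_sum has_vector_derivative_scaleR
        has_vector_derivative_at_within[OF L_deriv])
      (use assms in \<open>auto simp: has_real_derivative_iff_has_vector_derivative
        intro!: bounded_linear.has_vector_derivative[OF bounded_linear_inner_left]\<close>)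
  then show ?thesis
    by (simp add: sum.distrib flip: expand Mexpand)
qed

end

lemma smooth_map_differentiable: "smooth_map f \<Longrightarrow> f differentiable (at x)"
  unfolding smooth_map_def by (metis Ck_map.simps(2))

text \<open>Since the automorphisms in the flow are conjugated to linear maps by the exponential, the
  vector field itself is the image of the generator \<open>M\<close> under the differential of \<open>hexp\<close>.\<close>

lemma linear_field_imp_heis_flow:
  assumes "linear_field X"
  obtains L M where "heis_flow L M" and "\<And>v. X (hexp v) = hexp_deriv v (M v)"
proof -
  obtain \<phi> where \<phi>0: "\<And>g. \<phi> 0 g = g"
    and \<phi>': "\<And>t g. ((\<lambda>s. \<phi> s g) has_vector_derivative X (\<phi> t g)) (at t)"
    and \<phi>_plus: "\<And>s t. \<phi> (s + t) = \<phi> s \<circ> \<phi> t"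
    and \<phi>_aut: "\<And>t. heis_automorphism (\<phi> t)"
    using assms unfolding linear_field_def by metis
  define L where "L = (\<lambda>t v. hlog (\<phi> t (hexp v)))"
  define M where "M = (\<lambda>v. hlog_deriv (hexp v) (X (hexp v)))"
  have diff: "\<phi> t differentiable (at g)"
    and hom: "\<phi> t (heis_mult g h) = heis_mult (\<phi> t g) (\<phi> t h)" for t g h
    using \<phi>_aut[of t] smooth_map_differentiable unfolding heis_automorphism_def by blast+
  note L_hom = hexp_conjugate_hom[of "\<phi> t" for t, OF diff hom]
  have "heis_flow L M"
  proof (rule heis_flow.intro)
    show "linear (L t)" for t
      unfolding L_def by (rule L_hom(1))
    show "L t (brk v w) = brk (L t v) (L t w)" for t v w
      unfolding L_def by (rule L_hom(2))
    show "L 0 v = v" "L (s + t) v = L s (L t v)" for s t v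
      by (simp_all add: L_def \<phi>0 \<phi>_plus)
    show "((\<lambda>s. L s v) has_vector_derivative M (L t v)) (at t)" for t v
    proof -
      have "((\<lambda>s. hlog (\<phi> s (hexp v))) has_vector_derivative
          hlog_deriv (\<phi> t (hexp v)) (X (\<phi> t (hexp v)))) (at t)"
        using vector_derivative_diff_chain_within[OF \<phi>'[of "hexp v" t] hlog_has_derivative]
        unfolding o_def .
      then show ?thesis
        by (simp add: L_def M_def)
    qed
  qed
  moreover have "X (hexp v) = hexp_deriv v (M v)" for v
    by (simp add: M_def hexp_deriv_hlog_deriv)
  ultimately show thesis
    by (rule that)
qed

section \<open>Right-invariant fields and the rank condition\<close>

text \<open>The right-invariant field with value \<open>v\<close> at the identity \<open>0\<close>.\<close>

definition rfield :: "'n::finite heis \<Rightarrow> 'n vfield" where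
  "rfield v = (\<lambda>(x, y, z). (fst v, fst (snd v), snd (snd v) + fst (snd v) \<bullet> x))"

lemma right_invariant_iff_rfield: "right_invariant V \<longleftrightarrow> (\<exists>v. V = rfield v)"
  by (simp add: right_invariant_iff rfield_def split_paired_Ex)

lemma rfield_add: "rfield v g + rfield w g = rfield (v + w) g"
  and rfield_scale: "c *\<^sub>R rfield v g = rfield (c *\<^sub>R v) g"
  and rfield_0: "rfield 0 g = 0"
  by (cases g; simp add: rfield_def inner_add_left zero_prod_def algebra_simps)+

lemma rfield_at_0: "rfield v 0 = v"
  by (simp add: rfield_def zero_prod_def)

lemma lie_bracket_rfield: "lie_bracket (rfield v) (rfield w) = rfield (brk w v)"
  using lie_bracket_right_invariant[of "fst v" "fst (snd v)" "snd (snd v)"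
      "fst w" "fst (snd w)" "snd (snd w)"]
  unfolding rfield_def brk_def vert_def symplectic_def horiz_def
  by (simp add: fun_eq_iff inner_commute)

text \<open>In logarithmic coordinates a right-invariant field is affine in the point \<open>\<zeta>\<close>: it is the
  derivative at \<open>s = 0\<close> of the product of \<open>s v\<close> and \<open>\<zeta>\<close>.\<close>

lemma rfield_hexp: "rfield v (hexp \<zeta>) = hexp_deriv \<zeta> (v + (1/2) *\<^sub>R brk v \<zeta>)"
  by (cases v; cases \<zeta>) (simp add: rfield_def hexp_def hexp_deriv_def brk_def vert_def symplectic_def
      horiz_def inner_commute field_simps)

lemma rfield_has_derivative:
  "(rfield v has_derivative (\<lambda>h. vert (fst (snd v) \<bullet> fst h))) (at g)"
  unfolding rfield_def vert_def case_prod_unfold by (auto intro!: derivative_eq_intros)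

text \<open>The derivation \<open>- ad X\<close> acts on the Lie algebra as the generator \<open>M\<close> of the flow. Write
  \<open>\<zeta> = hlog g\<close>. Differentiating \<open>X = M (hlog g) + \<dots>\<close> along the field produces the
  right-invariant field of \<open>M v\<close>, half of the bracket of \<open>v\<close> with \<open>M \<zeta>\<close> and half of the
  symmetric product of \<open>v\<close> and \<open>M \<zeta>\<close>. The last two add up to the derivative of the field along \<open>X\<close>,
  which the Lie bracket subtracts.\<close>

lemma derivation_of_rfield:
  fixes X :: "'n::finite vfield"
  assumes flow: "heis_flow L M" and X: "\<And>v. X (hexp v) = hexp_deriv v (M v)"
  shows "derivation_of X (rfield v) = rfield (M v)"
proof
  fix g :: "'n heis"
  interpret heis_flow L M by fact
  define \<zeta> where "\<zeta> = hlog g"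
  define sym where "sym = (\<lambda>(v :: 'n heis) (w :: 'n heis). fst (snd v) \<bullet> fst w + fst (snd w) \<bullet> fst v)"
  define \<delta> where "\<delta> = v + (1/2) *\<^sub>R brk v \<zeta>"
  have hexp_deriv_eq: "hexp_deriv v w = w + vert (sym v w / 2)" for v w :: "'n heis"
    by (cases v; cases w) (simp add: hexp_deriv_def vert_def sym_def algebra_simps)
  have sym_horiz: "sym v w = sym v' w'" if "horiz v = horiz v'" "horiz w = horiz w'" for v w v' w'
    using that by (simp add: sym_def horiz_def)
  have "bounded_bilinear sym"
    unfolding bilinear_conv_bounded_bilinear[symmetric] bilinear_def sym_def
    by (auto intro!: linearI simp: inner_add_left inner_add_right algebra_simps)
  note sym_deriv = bounded_bilinear.FDERIV[OF this]
  have M: "bounded_linear M"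
    using M_linear by (simp add: linear_conv_bounded_linear)
  have v: "bounded_linear (vert :: real \<Rightarrow> 'n heis)"
    using linear_vert by (simp add: linear_conv_bounded_linear)
  have "X = (\<lambda>g. M (hlog g) + vert (sym (hlog g) (M (hlog g)) * (1/2)))"
  proof
    show "X g = M (hlog g) + vert (sym (hlog g) (M (hlog g)) * (1/2))" for g
      using X[of "hlog g"] by (simp add: hexp_deriv_eq)
  qed
  moreover
  define D where "D = hlog_deriv g"
  have hlog: "(hlog has_derivative D) (at g)"
    unfolding D_def by (rule hlog_has_derivative)
  note Mhlog = bounded_linear.has_derivative[OF M hlog]
  have "((\<lambda>g. M (hlog g) + vert (sym (hlog g) (M (hlog g)) * (1/2))) has_derivative
      (\<lambda>h. M (D h) + vert ((sym \<zeta> (M (D h)) + sym (D h) (M \<zeta>)) * (1/2)))) (at g)"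
    unfolding \<zeta>_def
    by (rule has_derivative_add[OF Mhlog bounded_linear.has_derivative[OF v
            has_derivative_mult_left[OF sym_deriv[OF hlog Mhlog]]]])
  ultimately have "(X has_derivative
      (\<lambda>h. M (D h) + vert ((sym \<zeta> (M (D h)) + sym (D h) (M \<zeta>)) * (1/2)))) (at g)"
    by (simp only:)
  then have dX: "frechet_derivative X (at g) =
      (\<lambda>h. M (D h) + vert ((sym \<zeta> (M (D h)) + sym (D h) (M \<zeta>)) * (1/2)))"
    by (rule frechet_derivative_at[symmetric])
  have D: "D (rfield v g) = \<delta>"
    by (cases v; cases g) (simp add: D_def hlog_deriv_def rfield_def \<delta>_def \<zeta>_def hlog_def brk_def
        vert_def symplectic_def horiz_def inner_commute field_simps)
  have M\<delta>: "M \<delta> = M v + (1/2) *\<^sub>R brk (M v) \<zeta> + (1/2) *\<^sub>R brk v (M \<zeta>)"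
    by (simp add: \<delta>_def linear_add[OF M_linear] linear_scale[OF M_linear] M_brk scaleR_add_right)
  have "horiz \<delta> = horiz v" "horiz (M \<delta>) = horiz (M v)"
    by (simp_all add: M\<delta> linear_add[OF linear_horiz] linear_scale[OF linear_horiz])
      (simp add: \<delta>_def linear_add[OF linear_horiz] linear_scale[OF linear_horiz])
  then have s: "sym \<zeta> (M \<delta>) = sym \<zeta> (M v)" "sym \<delta> (M \<zeta>) = sym v (M \<zeta>)"
    by (auto intro: sym_horiz)
  have sw: "sym \<zeta> (M v + (1/2) *\<^sub>R brk (M v) \<zeta>) = sym \<zeta> (M v)"
    by (rule sym_horiz) (simp_all add: linear_add[OF linear_horiz] linear_scale[OF linear_horiz])
  have vert_half: "vert ((r + s) * (1/2)) = vert (r / 2) + vert (s / 2)" for r s :: real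
    by (simp add: vert_def field_simps)
  have horiz_X: "fst (X g) = fst (M \<zeta>)"
    using X[of \<zeta>] by (simp add: \<zeta>_def hexp_deriv_eq) (simp add: vert_def)
  have dV: "frechet_derivative (rfield v) (at g) (X g) = vert (fst (snd v) \<bullet> fst (M \<zeta>))"
    by (simp add: frechet_derivative_at[OF rfield_has_derivative[of v g], symmetric] horiz_X)
  have cancel: "(1/2) *\<^sub>R brk v (M \<zeta>) + vert (sym v (M \<zeta>) / 2) = vert (fst (snd v) \<bullet> fst (M \<zeta>))"
    by (simp add: brk_def vert_def symplectic_def horiz_def sym_def inner_commute field_simps)
  have "derivation_of X (rfield v) g
      = M \<delta> + vert ((sym \<zeta> (M \<delta>) + sym \<delta> (M \<zeta>)) * (1/2)) - vert (fst (snd v) \<bullet> fst (M \<zeta>))"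
    by (simp add: derivation_of_def lie_bracket_def dX dV D)
  also have "\<dots> = hexp_deriv \<zeta> (M v + (1/2) *\<^sub>R brk (M v) \<zeta>)
      + ((1/2) *\<^sub>R brk v (M \<zeta>) + vert (sym v (M \<zeta>) / 2)) - vert (fst (snd v) \<bullet> fst (M \<zeta>))"
    unfolding hexp_deriv_eq s sw vert_half unfolding M\<delta> by (simp only: ac_simps)
  also have "\<dots> = rfield (M v) g"
    unfolding cancel using rfield_hexp[of "M v" \<zeta>] by (simp add: \<zeta>_def)
  finally show "derivation_of X (rfield v) g = rfield (M v) g" .
qed

text \<open>Modulo the center the algebra is abelian, so there the rank condition is the Kalman rank
  condition: a functional \<open>\<theta>\<close> that vanishes on the horizontal parts of all \<open>D\<^sup>k B\<^sub>j\<close> cuts out a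
  Lie subalgebra, because all brackets are central, and this subalgebra contains the generators.\<close>

lemma rank_condition_imp_spanning:
  fixes b :: "'m::finite \<Rightarrow> 'n::finite heis"
  assumes flow: "heis_flow L M" and X: "\<And>v. X (hexp v) = hexp_deriv v (M v)"
    and rank: "rank_condition X (\<lambda>j. rfield (b j))"
    and orth: "\<And>k j. \<theta> \<bullet> horiz ((M ^^ k) (b j)) = 0"
  shows "\<theta> = 0"
proof -
  have pow: "(derivation_of X ^^ k) (rfield v) = rfield ((M ^^ k) v)" for k v
    by (induction k) (simp_all add: derivation_of_rfield[OF flow X])
  define H where "H = rfield ` {v. \<theta> \<bullet> horiz v = 0}"
  note horiz_lin = linear_add[OF linear_horiz] linear_scale[OF linear_horiz]
  have "lie_subalgebra H"
    unfolding lie_subalgebra_def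
  proof (intro conjI ballI allI)
    show "H \<subseteq> heis_algebra"
      unfolding H_def heis_algebra_def right_invariant_iff_rfield by blast
    show "(\<lambda>g. 0) \<in> H"
      unfolding H_def by (rule image_eqI[of _ _ 0]) (auto simp: rfield_0 linear_0[OF linear_horiz])
    show "(\<lambda>g. c *\<^sub>R V g) \<in> H" if V: "V \<in> H" for c V
    proof -
      obtain v where [simp]: "V = rfield v" "\<theta> \<bullet> horiz v = 0"
        using V unfolding H_def by blast
      show ?thesis
        unfolding H_def by (rule image_eqI[of _ _ "c *\<^sub>R v"]) (simp_all add: rfield_scale horiz_lin)
    qed
    fix V W assume "V \<in> H" "W \<in> H"
    then obtain v w where [simp]: "V = rfield v" "W = rfield w" "\<theta> \<bullet> horiz v = 0" "\<theta> \<bullet> horiz w = 0"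
      unfolding H_def by blast
    show "(\<lambda>g. V g + W g) \<in> H"
      unfolding H_def by (rule image_eqI[of _ _ "v + w"]) (simp_all add: rfield_add horiz_lin inner_add_right)
    show "lie_bracket V W \<in> H"
      unfolding H_def by (rule image_eqI[of _ _ "brk w v"]) (simp_all add: lie_bracket_rfield)
  qed
  moreover have "{(derivation_of X ^^ k) (rfield (b j)) | k j. True} \<subseteq> H"
    using orth by (auto simp: pow H_def)
  ultimately have "lie_subalgebra hull {(derivation_of X ^^ k) (rfield (b j)) | k j. True} \<subseteq> H"
    by (intro hull_minimal)
  then have "heis_algebra \<subseteq> H"
    using rank unfolding rank_condition_def lie_generated_def by simp
  moreover have "rfield (fst \<theta>, snd \<theta>, 0) \<in> heis_algebra"
    by (auto simp: heis_algebra_def right_invariant_iff_rfield)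
  ultimately obtain v where "rfield (fst \<theta>, snd \<theta>, 0) = rfield v" "\<theta> \<bullet> horiz v = 0"
    unfolding H_def by blast
  then have "\<theta> \<bullet> horiz (fst \<theta>, snd \<theta>, 0) = 0"
    by (metis rfield_at_0)
  then show ?thesis
    by (simp add: horiz_def)
qed

text \<open>A functional that annihilates the curves \<open>L (- t) (b j)\<close> on a time interval also annihilates
  their derivatives, which at time \<open>0\<close> are \<open>M\<^sup>k (b j)\<close> up to sign.\<close>

lemma (in heis_flow) kalman_observability:
  assumes "T > 0" and spanning: "(\<And>k j. \<theta> \<bullet> horiz ((M ^^ k) (b j)) = 0) \<Longrightarrow> \<theta> = 0"
    and zero: "\<And>j t. t \<in> {0..T} \<Longrightarrow> \<theta> \<bullet> horiz (L (- t) (b j)) = 0"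
  shows "\<theta> = 0"
proof (rule spanning)
  fix k j
  have "\<forall>t\<in>{0..T}. \<theta> \<bullet> horiz (L (- t) ((M ^^ k) (b j))) = 0"
  proof (induction k)
    case 0
    then show ?case using zero by simp
  next
    case (Suc k)
    define v where "v = (M ^^ k) (b j)"
    show ?case
    proof
      fix t assume t: "t \<in> {0..T}"
      have bl: "bounded_linear (\<lambda>v. \<theta> \<bullet> horiz v)"
        unfolding linear_conv_bounded_linear[symmetric]
        by (rule linearI) (simp_all add: linear_add[OF linear_horiz] linear_scale[OF linear_horiz] inner_add_right)
      have "((\<lambda>t. - t) has_vector_derivative - 1) (at t within {0..T})"
        by (auto intro!: derivative_eq_intros)
      from vector_diff_chain_within[OF this has_vector_derivative_at_within[OF L_deriv[of v "- t"]]]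
      have "((\<lambda>t. L (- t) v) has_vector_derivative - L (- t) (M v)) (at t within {0..T})"
        by (simp add: o_def M_L)
      from bounded_linear.has_vector_derivative[OF bl this]
      have "((\<lambda>t. \<theta> \<bullet> horiz (L (- t) v)) has_vector_derivative - (\<theta> \<bullet> horiz (L (- t) (M v))))
          (at t within {0..T})"
        by (simp add: linear_neg[OF linear_horiz])
      then have "((\<lambda>t. 0) has_vector_derivative - (\<theta> \<bullet> horiz (L (- t) (M v)))) (at t within {0..T})"
        by (rule has_vector_derivative_transform[rotated 2]) (use Suc t in \<open>simp_all add: v_def\<close>)
      then have "- (\<theta> \<bullet> horiz (L (- t) (M v))) = 0"
        using vector_derivative_unique_within_closed_interval[of 0 T t "\<lambda>t. 0 :: real"
            "- (\<theta> \<bullet> horiz (L (- t) (M v)))" 0] t \<open>T > 0\<close>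
        by simp
      then show "\<theta> \<bullet> horiz (L (- t) ((M ^^ Suc k) (b j))) = 0"
        by (simp add: v_def)
    qed
  qed
  then show "\<theta> \<bullet> horiz ((M ^^ k) (b j)) = 0"
    using \<open>T > 0\<close> by (metis L_0 atLeastAtMost_iff less_eq_real_def minus_zero)
qed

lemma generates_center_imp_vert:
  fixes Z :: "'n::finite vfield"
  assumes "generates_center Z"
  obtains r where "r \<noteq> 0" "Z = rfield (vert r)"
proof -
  have eq: "{\<lambda>g. c *\<^sub>R Z g | c. True} = {\<lambda>g. c *\<^sub>R (0, 0, 1) | c. True}"
    using assms generates_center_Z unfolding generates_center_def by (rule trans[OF sym])
  have "(\<lambda>g. 1 *\<^sub>R Z g) \<in> {\<lambda>g. c *\<^sub>R Z g | c. True}"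
    by blast
  then obtain r where r: "Z = (\<lambda>g. r *\<^sub>R (0, 0, 1))"
    unfolding eq by auto
  have "(\<lambda>g :: 'n heis. 1 *\<^sub>R ((0, 0, 1) :: 'n heis)) \<in> {\<lambda>g. c *\<^sub>R (0, 0, 1) | c. True}"
    by blast
  then obtain c where "(\<lambda>g. 1 *\<^sub>R (0, 0, 1)) = (\<lambda>g. c *\<^sub>R Z g)"
    unfolding eq[symmetric] by blast
  then have "r \<noteq> 0"
    unfolding r by (auto simp: fun_eq_iff)
  moreover have "Z = rfield (vert r)"
    by (auto simp: r rfield_def vert_def)
  ultimately show thesis
    by (rule that)
qed

text \<open>The center can enter the algebra generated by the controlled fields in two ways. Either two
  of the fields do not commute, or all commute; then their span is already a Lie algebra, and
  a constant combination of them is central and nonzero.\<close>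

lemma center_generated_cases:
  fixes b :: "'m::finite \<Rightarrow> 'n::finite heis"
  assumes "generates_center Z" and "Z \<in> lie_generated (range (\<lambda>j. rfield (b j)))"
  obtains (area) i j where "symplectic (horiz (b i)) (horiz (b j)) \<noteq> 0"
  | (direct) \<beta> r where "r \<noteq> 0" "(\<Sum>j\<in>UNIV. \<beta> j *\<^sub>R b j) = vert r"
proof (cases "\<exists>i j. symplectic (horiz (b i)) (horiz (b j)) \<noteq> 0")
  case True
  then show thesis using area by blast
next
  case False
  then have brk0: "brk (b i) (b j) = 0" for i j
    by (simp add: brk_def vert_def zero_prod_def)
  define comb where "comb = (\<lambda>\<beta>. \<Sum>j\<in>UNIV. \<beta> j *\<^sub>R b j)"
  have brk_comb: "brk (comb \<beta>) (comb \<beta>') = 0" for \<beta> \<beta>'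
    by (simp add: comb_def linear_sum[OF linear_brk_left] linear_sum[OF linear_brk_right]
        brk_simps brk0)
  define H where "H = range (\<lambda>\<beta>. rfield (comb \<beta>))"
  have "lie_subalgebra H"
    unfolding lie_subalgebra_def
  proof (intro conjI ballI allI)
    show "H \<subseteq> heis_algebra"
      unfolding H_def heis_algebra_def right_invariant_iff_rfield by blast
    show 0: "(\<lambda>g. 0) \<in> H"
      unfolding H_def by (rule image_eqI[of _ _ "\<lambda>j. 0"]) (auto simp: rfield_0 comb_def)
    show "(\<lambda>g. c *\<^sub>R V g) \<in> H" if "V \<in> H" for c V
    proof -
      obtain \<beta> where "V = rfield (comb \<beta>)"
        using \<open>V \<in> H\<close> unfolding H_def by blast
      then show ?thesis
        unfolding H_def by (intro image_eqI[of _ _ "\<lambda>j. c * \<beta> j"])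
          (auto simp: rfield_scale comb_def scaleR_sum_right)
    qed
    fix V W assume "V \<in> H" "W \<in> H"
    then obtain \<beta> \<beta>' where VW: "V = rfield (comb \<beta>)" "W = rfield (comb \<beta>')"
      unfolding H_def by blast
    then show "(\<lambda>g. V g + W g) \<in> H"
      unfolding H_def by (intro image_eqI[of _ _ "\<lambda>j. \<beta> j + \<beta>' j"])
        (auto simp: rfield_add comb_def sum.distrib scaleR_left_distrib)
    show "lie_bracket V W \<in> H"
      using 0 by (simp add: VW lie_bracket_rfield brk_comb rfield_0[abs_def] cong: if_cong)
  qed
  moreover have "range (\<lambda>j. rfield (b j)) \<subseteq> H"
  proof
    fix V assume "V \<in> range (\<lambda>j. rfield (b j))"
    then obtain j where "V = rfield (b j)" by blast
    then show "V \<in> H"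
      unfolding H_def
      by (intro image_eqI[of _ _ "\<lambda>i. if i = j then 1 else 0"])
        (auto simp: comb_def if_distrib[of "\<lambda>x. x *\<^sub>R _"] sum.delta cong: if_cong)
  qed
  ultimately have "lie_subalgebra hull range (\<lambda>j. rfield (b j)) \<subseteq> H"
    by (intro hull_minimal)
  then have "Z \<in> H"
    using assms(2) unfolding lie_generated_def by (rule subsetD)
  then obtain \<beta> where "Z = rfield (comb \<beta>)"
    unfolding H_def by blast
  moreover obtain r where "r \<noteq> 0" "Z = rfield (vert r)"
    using generates_center_imp_vert[OF assms(1)] .
  ultimately show thesis
    using direct[of r \<beta>] rfield_at_0 unfolding comb_def by metis
qed

section \<open>Steering a driftless system with a vertical coordinate\<close>

text \<open>A perturbation \<open>e\<close> that is small together with its derivative changes the area of a small curve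
  \<open>g\<close> by a second-order term only, even when the velocity \<open>g'\<close> is large: only
  \<open>\<omega> g' e\<close> could be of lower order, and integration by parts moves the derivative onto \<open>e\<close>.\<close>

lemma area_perturbation:
  fixes g e :: "real \<Rightarrow> 'a::euclidean_space" and \<omega> :: "'a \<Rightarrow> 'a \<Rightarrow> real"
  assumes bil: "bounded_bilinear \<omega>" and K: "\<And>a b. \<bar>\<omega> a b\<bar> \<le> K * (norm a * norm b)" "K \<ge> 0"
    and "T \<ge> 0"
    and g': "\<And>t. t \<in> {0..T} \<Longrightarrow> (g has_vector_derivative g' t) (at t within {0..T})"
    and e': "\<And>t. t \<in> {0..T} \<Longrightarrow> (e has_vector_derivative e' t) (at t within {0..T})"
    and cont: "continuous_on {0..T} g'" "continuous_on {0..T} e'"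
    and small: "\<And>t. t \<in> {0..T} \<Longrightarrow> norm (g t) \<le> \<delta>" "\<And>t. t \<in> {0..T} \<Longrightarrow> norm (e t) \<le> \<delta>"
      "\<And>t. t \<in> {0..T} \<Longrightarrow> norm (e' t) \<le> \<delta>"
  shows "\<bar>integral {0..T} (\<lambda>t. \<omega> (g' t + e' t) (g t + e t)) - integral {0..T} (\<lambda>t. \<omega> (g' t) (g t))\<bar>
    \<le> K * \<delta>\<^sup>2 * (2 + 3 * T)"
proof -
  interpret bounded_bilinear \<omega> by (rule bil)
  have cg: "continuous_on {0..T} g" and ce: "continuous_on {0..T} e"
    using g' e' continuous_on_vector_derivative by blast+
  note cont_\<omega> = continuous_on[OF cont(1) cg] continuous_on[OF cont(1) ce]
    continuous_on[OF cont(2) cg] continuous_on[OF cont(2) ce] continuous_on[OF cg cont(2)]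
  have K\<delta>: "\<bar>\<omega> a b\<bar> \<le> K * \<delta>\<^sup>2" if "norm a \<le> \<delta>" "norm b \<le> \<delta>" for a b
  proof -
    have "norm a * norm b \<le> \<delta> * \<delta>"
      using that by (intro mult_mono) (auto intro: order_trans[OF norm_ge_zero])
    then show ?thesis
      using K(1)[of a b] K(2) by (simp add: power2_eq_square order_trans mult_left_mono)
  qed
  define r where "r = (\<lambda>t. \<omega> (e' t) (g t) + \<omega> (e' t) (e t) - \<omega> (g t) (e' t))"
  define s where "s = (\<lambda>t. \<omega> (g t) (e' t) + \<omega> (g' t) (e t))"
  have "((\<lambda>t. \<omega> (g t) (e t)) has_vector_derivative s t) (at t within {0..T})" if "t \<in> {0..T}" for t
    unfolding s_def by (rule has_vector_derivative[OF g'[OF that] e'[OF that]])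
  from fundamental_theorem_of_calculus[OF \<open>T \<ge> 0\<close> this]
  have s: "integral {0..T} s = \<omega> (g T) (e T) - \<omega> (g 0) (e 0)"
    by (simp add: integral_unique)
  have int: "(\<lambda>t. \<omega> (g' t) (g t)) integrable_on {0..T}" "s integrable_on {0..T}" "r integrable_on {0..T}"
    unfolding s_def r_def by (intro integrable_continuous_real continuous_intros cont_\<omega>)+
  have "integral {0..T} (\<lambda>t. \<omega> (g' t + e' t) (g t + e t))
      = integral {0..T} (\<lambda>t. \<omega> (g' t) (g t) + (s t + r t))"
    by (simp add: s_def r_def add_left add_right algebra_simps)
  also have "\<dots> = integral {0..T} (\<lambda>t. \<omega> (g' t) (g t)) + (integral {0..T} s + integral {0..T} r)"
    by (simp only: integral_add integrable_add int)
  finally have "\<bar>integral {0..T} (\<lambda>t. \<omega> (g' t + e' t) (g t + e t)) - integral {0..T} (\<lambda>t. \<omega> (g' t) (g t))\<bar>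
      \<le> \<bar>integral {0..T} s\<bar> + \<bar>integral {0..T} r\<bar>"
    by simp
  moreover have "\<bar>integral {0..T} s\<bar> \<le> 2 * (K * \<delta>\<^sup>2)"
  proof -
    have "\<bar>\<omega> (g T) (e T)\<bar> \<le> K * \<delta>\<^sup>2" "\<bar>\<omega> (g 0) (e 0)\<bar> \<le> K * \<delta>\<^sup>2"
      using \<open>T \<ge> 0\<close> by (intro K\<delta> small; simp)+
    then show ?thesis
      unfolding s by linarith
  qed
  moreover have "\<bar>integral {0..T} r\<bar> \<le> (3 * (K * \<delta>\<^sup>2)) * (T - 0)"
  proof (subst real_norm_def[symmetric], rule integral_bound)
    show "continuous_on {0..T} r"
      unfolding r_def by (intro continuous_intros cont_\<omega>)
    fix t assume t: "t \<in> {0..T}"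
    then have "\<bar>\<omega> (e' t) (g t)\<bar> \<le> K * \<delta>\<^sup>2" "\<bar>\<omega> (e' t) (e t)\<bar> \<le> K * \<delta>\<^sup>2" "\<bar>\<omega> (g t) (e' t)\<bar> \<le> K * \<delta>\<^sup>2"
      by (intro K\<delta> small; simp)+
    then show "norm (r t) \<le> 3 * (K * \<delta>\<^sup>2)"
      unfolding r_def real_norm_def by linarith
  qed fact
  ultimately show ?thesis
    by (simp add: algebra_simps)
qed

text \<open>The driftless time-varying system obtained by variation of constants: \<open>p' = \<Sum> u\<^sub>j w\<^sub>j\<close> in the
  horizontal space, and a vertical coordinate that accumulates the symplectic area swept by \<open>p\<close>
  together with a term linear in the input. The last assumption excludes that some direction is
  invisible to all control directions \<open>w\<^sub>j\<close> during the time interval.\<close>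

locale steering =
  fixes \<omega> :: "'a::euclidean_space \<Rightarrow> 'a \<Rightarrow> real" and w :: "'m::finite \<Rightarrow> real \<Rightarrow> 'a" and T :: real
  assumes bilinear: "bounded_bilinear \<omega>"
    and alternating: "\<omega> p p = 0"
    and w_cont: "continuous_on UNIV (w j)"
    and T_pos: "T > 0"
    and spanning: "(\<And>j t. t \<in> {0..T} \<Longrightarrow> \<theta> \<bullet> w j t = 0) \<Longrightarrow> \<theta> = 0"
begin

interpretation bounded_bilinear \<omega> by (rule bilinear)

definition vel :: "(real \<Rightarrow> real^'m) \<Rightarrow> real \<Rightarrow> 'a" where
  "vel u t = (\<Sum>j\<in>UNIV. u t $ j *\<^sub>R w j t)"

definition pos :: "(real \<Rightarrow> real^'m) \<Rightarrow> real \<Rightarrow> 'a" where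
  "pos u t = integral {0..t} (vel u)"

definition area :: "(real \<Rightarrow> real^'m) \<Rightarrow> real" where
  "area u = integral {0..T} (\<lambda>t. \<omega> (vel u t) (pos u t))"

lemma vel_linear: "vel (\<lambda>t. u t + s *\<^sub>R v t) = (\<lambda>t. vel u t + s *\<^sub>R vel v t)"
  by (simp add: fun_eq_iff vel_def sum.distrib scaleR_left_distrib scaleR_sum_right)

lemma vel_cont:
  assumes "continuous_on UNIV u"
  shows "continuous_on S (vel u)"
  unfolding vel_def[abs_def]
  by (intro continuous_intros continuous_on_subset[OF w_cont] continuous_on_subset[OF assms]
      subset_UNIV)

lemma vel_integrable: "continuous_on UNIV u \<Longrightarrow> vel u integrable_on {0..t}"
  by (rule integrable_continuous_real[OF vel_cont])

lemma pos_linear: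
  assumes "continuous_on UNIV u" "continuous_on UNIV v"
  shows "pos (\<lambda>t. u t + s *\<^sub>R v t) t = pos u t + s *\<^sub>R pos v t"
  unfolding pos_def vel_linear
  by (subst integral_add) (auto intro!: vel_integrable integrable_cmul assms)

lemma pos_0 [simp]: "pos u 0 = 0"
  by (simp add: pos_def)

lemma pos_deriv:
  assumes "continuous_on UNIV u" "t \<in> {0..T}"
  shows "(pos u has_vector_derivative vel u t) (at t within {0..T})"
  unfolding pos_def[abs_def]
  using integral_has_vector_derivative[OF vel_cont[OF assms(1)] assms(2)] .

lemma pos_cont: "continuous_on UNIV u \<Longrightarrow> continuous_on {0..T} (pos u)"
  using pos_deriv continuous_on_vector_derivative by blast

text \<open>A vector \<open>\<theta>\<close> orthogonal to all endpoints is in particular orthogonal to the endpoint of the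
  input \<open>u\<^sub>j = \<theta> \<bullet> w\<^sub>j\<close>, and this says that the integral of \<open>\<Sum> (\<theta> \<bullet> w\<^sub>j)\<^sup>2\<close> vanishes.\<close>

lemma pos_onto: "\<exists>u. continuous_on UNIV u \<and> pos u T = v"
proof -
  define R where "R = {pos u T | u. continuous_on UNIV u}"
  have R_I: "pos u T \<in> R" if "continuous_on UNIV u" for u
    unfolding R_def using that by (intro CollectI exI[of _ u] conjI refl)
  have R_E: "\<exists>u. continuous_on UNIV u \<and> pos u T = x" if "x \<in> R" for x
    using that by (auto simp: R_def)
  have lin: "x + s *\<^sub>R y \<in> R" if xy: "x \<in> R" "y \<in> R" for x y s
  proof -
    obtain u v where uv: "continuous_on UNIV u" "continuous_on UNIV v"
      and [simp]: "pos u T = x" "pos v T = y"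
      using R_E[OF xy(1)] R_E[OF xy(2)] by (elim exE conjE)
    have "pos (\<lambda>t. u t + s *\<^sub>R v t) T \<in> R"
      by (intro R_I continuous_intros uv)
    then show ?thesis
      by (simp add: pos_linear[OF uv])
  qed
  have 0: "0 \<in> R"
    using R_I[OF continuous_on_const[of UNIV 0]] by (simp add: pos_def vel_def[abs_def])
  have "subspace R"
    unfolding subspace_def using 0 lin[of _ _ 1] lin[OF 0] by simp
  then have span: "span R = R"
    by (simp add: span_eq_iff)
  have "R = UNIV"
  proof (rule ccontr)
    assume "R \<noteq> UNIV"
    then have "dim R < DIM('a)"
      using dim_eq_full[of R] dim_subset_UNIV[of R] span by (simp add: order_less_le)
    then obtain \<theta> where "\<theta> \<noteq> 0" and "\<And>y. y \<in> span R \<Longrightarrow> orthogonal \<theta> y"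
      using orthogonal_to_subspace_exists by blast
    then have orth: "\<theta> \<bullet> pos u T = 0" if "continuous_on UNIV u" for u
      using R_I[OF that] span by (simp add: orthogonal_def)
    define u :: "real \<Rightarrow> real^'m" where "u = (\<lambda>t. \<chi> j. \<theta> \<bullet> w j t)"
    have u: "continuous_on UNIV u"
      unfolding u_def by (intro continuous_intros w_cont)
    have "\<theta> \<bullet> pos u T = integral {0..T} (\<lambda>t. \<theta> \<bullet> vel u t)"
      using integral_linear[OF vel_integrable[OF u] bounded_linear_inner_right[of \<theta>]]
      by (simp add: o_def pos_def)
    also have "\<dots> = integral {0..T} (\<lambda>t. \<Sum>j\<in>UNIV. (\<theta> \<bullet> w j t)\<^sup>2)"
      by (simp add: vel_def u_def inner_sum_right power2_eq_square)
    finally have "integral {0..T} (\<lambda>t. \<Sum>j\<in>UNIV. (\<theta> \<bullet> w j t)\<^sup>2) = 0"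
      using orth[OF u] by simp
    moreover have "continuous_on {0..T} (\<lambda>t. \<Sum>j\<in>UNIV. (\<theta> \<bullet> w j t)\<^sup>2)"
      by (intro continuous_intros continuous_on_subset[OF w_cont]) simp
    ultimately have "\<forall>t\<in>{0..T}. (\<Sum>j\<in>UNIV. (\<theta> \<bullet> w j t)\<^sup>2) = 0"
      using T_pos by (subst integral_eq_0_iff[symmetric]) (auto intro: sum_nonneg)
    then have "\<theta> \<bullet> w j t = 0" if "t \<in> {0..T}" for j t
      using that by (subst (asm) sum_nonneg_eq_0_iff) auto
    with spanning \<open>\<theta> \<noteq> 0\<close> show False
      by blast
  qed
  then show ?thesis
    using R_E by simp
qed

text \<open>Inputs chosen for the basis vectors extend linearly to all endpoints. The resulting bound makes
  small endpoint errors correctable by small inputs.\<close>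

lemma pos_right_inverse:
  obtains \<rho> :: "'a \<Rightarrow> real \<Rightarrow> real^'m" and C where "C \<ge> 0" "\<And>v. continuous_on UNIV (\<rho> v)"
    "\<And>v. pos (\<rho> v) T = v" "\<And>v t. t \<in> {0..T} \<Longrightarrow> norm (vel (\<rho> v) t) \<le> C * norm v"
proof -
  obtain \<rho>0 where \<rho>0: "\<And>v. continuous_on UNIV (\<rho>0 v)" "\<And>v. pos (\<rho>0 v) T = v"
    using pos_onto by metis
  define \<rho> where "\<rho> = (\<lambda>v t. \<Sum>b\<in>Basis. (v \<bullet> b) *\<^sub>R \<rho>0 b t)"
  have "\<exists>c. \<forall>t\<in>{0..T}. norm (vel (\<rho>0 b) t) \<le> c" for b
    using compact_imp_bounded[OF compact_continuous_image[OF vel_cont[OF \<rho>0(1)] compact_Icc]]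
    by (auto simp: bounded_iff)
  then obtain c where c: "\<And>b t. t \<in> {0..T} \<Longrightarrow> norm (vel (\<rho>0 b) t) \<le> c b"
    by metis
  have vel: "vel (\<rho> v) t = (\<Sum>b\<in>Basis. (v \<bullet> b) *\<^sub>R vel (\<rho>0 b) t)" for v t
    unfolding vel_def \<rho>_def
    by (simp add: scaleR_sum_left scaleR_sum_right sum_component) (rule sum.swap)
  show thesis
  proof
    show "(\<Sum>b\<in>Basis. \<bar>c b\<bar>) \<ge> 0"
      by (simp add: sum_nonneg)
    show "continuous_on UNIV (\<rho> v)" for v
      unfolding \<rho>_def by (intro continuous_intros \<rho>0)
    show "pos (\<rho> v) T = v" for v
    proof -
      have "pos (\<rho> v) T = integral {0..T} (\<lambda>t. \<Sum>b\<in>Basis. (v \<bullet> b) *\<^sub>R vel (\<rho>0 b) t)"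
        unfolding pos_def by (rule integral_cong) (rule vel)
      also have "\<dots> = (\<Sum>b\<in>Basis. (v \<bullet> b) *\<^sub>R pos (\<rho>0 b) T)"
        by (subst integral_sum) (auto intro!: integrable_cmul vel_integrable \<rho>0 simp: pos_def)
      finally show ?thesis
        by (simp add: \<rho>0 euclidean_representation)
    qed
    show "norm (vel (\<rho> v) t) \<le> (\<Sum>b\<in>Basis. \<bar>c b\<bar>) * norm v" if t: "t \<in> {0..T}" for v t
    proof -
      have "norm (vel (\<rho> v) t) \<le> (\<Sum>b\<in>Basis. norm v * \<bar>c b\<bar>)"
        unfolding vel
      proof (rule sum_norm_le)
        fix b :: 'a assume "b \<in> Basis"
        then have "\<bar>v \<bullet> b\<bar> * norm (vel (\<rho>0 b) t) \<le> norm v * \<bar>c b\<bar>"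
          using c[OF t, of b] by (intro mult_mono Basis_le_norm) auto
        then show "norm ((v \<bullet> b) *\<^sub>R vel (\<rho>0 b) t) \<le> norm v * \<bar>c b\<bar>"
          by simp
      qed
      then show ?thesis
        by (simp add: sum_distrib_left mult.commute[of _ "norm v"])
    qed
  qed
qed

text \<open>Inputs that oscillate fast in two directions, with frequency \<open>N\<^sup>2\<close> and amplitude \<open>N\<close>, move
  along circles of radius \<open>1/N\<close> in these directions and therefore stay near the origin. Their
  turns, whose number grows like \<open>N\<^sup>2\<close>, together enclose an area that does not shrink: up to
  order \<open>1/N\<^sup>2\<close> it is \<open>-\<sigma>\<close> times the integral of \<open>\<omega> (w i) (w j)\<close>, where \<open>\<sigma>\<close> is the
  sense of rotation. The endpoint error, of order \<open>1/N\<close>, is corrected by an input of the same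
  order, which changes the area by order \<open>1/N\<^sup>2\<close> only.\<close>

lemma loops_of_both_signs:
  assumes w': "\<And>t. (w i has_vector_derivative w'i t) (at t)" "\<And>t. (w j has_vector_derivative w'j t) (at t)"
    and w'_cont: "continuous_on UNIV w'i" "continuous_on UNIV w'j"
    and I: "integral {0..T} (\<lambda>t. \<omega> (w i t) (w j t)) \<noteq> 0"
    and s: "\<bar>s\<bar> = 1"
  obtains k where "continuous_on UNIV k" "pos k T = 0" "s * area k > 0"
proof -
  define I where "I = integral {0..T} (\<lambda>t. \<omega> (w i t) (w j t))"
  define \<sigma> where "\<sigma> = - (s * sgn I)"
  have "I \<noteq> 0" using I unfolding I_def .
  then have \<sigma>: "\<bar>\<sigma>\<bar> = 1" "- \<sigma> * I = s * \<bar>I\<bar>"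
    using s by (auto simp: \<sigma>_def abs_mult sgn_if)
  obtain K where K: "K \<ge> 0" "\<And>a b. \<bar>\<omega> a b\<bar> \<le> K * (norm a * norm b)"
    using nonneg_bounded by (auto simp: mult_ac)
  obtain \<rho> Cr where \<rho>: "Cr \<ge> 0" "\<And>v. continuous_on UNIV (\<rho> v)" "\<And>v. pos (\<rho> v) T = v"
      "\<And>v t. t \<in> {0..T} \<Longrightarrow> norm (vel (\<rho> v) t) \<le> Cr * norm v"
    by (rule pos_right_inverse) blast
  have bdd: "\<exists>c. \<forall>t\<in>{0..T}. norm (f t) \<le> c" if "continuous_on UNIV f" for f :: "real \<Rightarrow> 'a"
    using compact_imp_bounded[OF compact_continuous_image[OF continuous_on_subset[OF that] compact_Icc]]
    by (auto simp: bounded_iff)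
  obtain A1 A2 A3 A4 where A1234: "\<And>t. t \<in> {0..T} \<Longrightarrow> norm (w i t) \<le> A1"
    "\<And>t. t \<in> {0..T} \<Longrightarrow> norm (w j t) \<le> A2" "\<And>t. t \<in> {0..T} \<Longrightarrow> norm (w'i t) \<le> A3"
    "\<And>t. t \<in> {0..T} \<Longrightarrow> norm (w'j t) \<le> A4"
    using bdd[OF w_cont[of i]] bdd[OF w_cont[of j]] bdd[OF w'_cont(1)] bdd[OF w'_cont(2)] by blast
  define A where "A = \<bar>A1\<bar> + \<bar>A2\<bar> + \<bar>A3\<bar> + \<bar>A4\<bar>"
  have A: "norm (w i t) \<le> A" "norm (w j t) \<le> A" "norm (w'i t) \<le> A" "norm (w'j t) \<le> A"
    if "t \<in> {0..T}" for t
    using A1234[OF that] unfolding A_def by linarith+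
  have "A \<ge> 0" by (simp add: A_def)
  \<comment> \<open>\<open>C1 / N\<close> will bound the derivative of the deviation from the circle, and \<open>C / N\<close> both the
     deviation and the circle.\<close>
  define C1 where "C1 = 2 * A + Cr * (4 * A + 2 * A * T)"
  define C where "C = 2 * A + C1 + C1 * T"
  have "C1 \<ge> 0" "C \<ge> 0"
    using \<open>A \<ge> 0\<close> \<rho>(1) T_pos by (simp_all add: C1_def C_def)
  obtain n :: nat where n: "K * C\<^sup>2 * (2 + 4 * T) / \<bar>I\<bar> < real n"
    using reals_Archimedean2 by blast
  define N where "N = real (Suc n)"
  have N: "N \<ge> 1" by (simp add: N_def)
  have N2: "K * (C / N)\<^sup>2 * (2 + 4 * T) < \<bar>I\<bar>"
  proof -
    have "K * C\<^sup>2 * (2 + 4 * T) < N * \<bar>I\<bar>"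
      using n \<open>I \<noteq> 0\<close> by (simp add: N_def field_simps)
    also have "\<dots> \<le> N\<^sup>2 * \<bar>I\<bar>"
      using N by (intro mult_right_mono) (auto simp: power2_eq_square)
    finally show ?thesis
      using N by (simp add: power_divide field_simps)
  qed
  define P where "P = (\<lambda>t. sin (N\<^sup>2 * t) / N)"
  define P' where "P' = (\<lambda>t. N * cos (N\<^sup>2 * t))"
  define Q where "Q = (\<lambda>t. - \<sigma> * cos (N\<^sup>2 * t) / N)"
  define Q' where "Q' = (\<lambda>t. \<sigma> * N * sin (N\<^sup>2 * t))"
  have P': "(P has_real_derivative P' t) (at t)" and Q': "(Q has_real_derivative Q' t) (at t)" for t
    unfolding P_def P'_def Q_def Q'_def using N
    by (auto intro!: derivative_eq_intros simp: power2_eq_square)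
  have PQ: "\<bar>P t\<bar> \<le> 1 / N" "\<bar>Q t\<bar> \<le> 1 / N" for t
    using N \<sigma>(1) by (auto simp: P_def Q_def abs_mult divide_simps)
  have PQ'_cont: "continuous_on S P'" "continuous_on S Q'" "continuous_on S P" "continuous_on S Q" for S
    unfolding P'_def Q'_def P_def Q_def using N by (auto intro!: continuous_intros)
  have wronskian: "P' t * Q t - Q' t * P t = - \<sigma>" for t
  proof -
    have "P' t * Q t = - \<sigma> * (cos (N\<^sup>2 * t))\<^sup>2" "Q' t * P t = \<sigma> * (sin (N\<^sup>2 * t))\<^sup>2"
      using N by (simp_all add: P_def P'_def Q_def Q'_def power2_eq_square)
    then have "P' t * Q t - Q' t * P t = - \<sigma> * ((sin (N\<^sup>2 * t))\<^sup>2 + (cos (N\<^sup>2 * t))\<^sup>2)"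
      by (simp only: distrib_left)
    then show ?thesis by simp
  qed
  define \<kappa> :: "real \<Rightarrow> real^'m" where "\<kappa> = (\<lambda>t. P' t *\<^sub>R axis i 1 + Q' t *\<^sub>R axis j 1)"
  have \<kappa>: "continuous_on UNIV \<kappa>"
    unfolding \<kappa>_def by (intro continuous_intros PQ'_cont)
  have vel_axis: "(\<Sum>l\<in>UNIV. (axis k 1 :: real^'m) $ l *\<^sub>R w l t) = w k t" for k t
    by (simp add: axis_def if_distrib[of "\<lambda>x. x *\<^sub>R _"] cong: if_cong)
  have vel_\<kappa>: "vel \<kappa> t = P' t *\<^sub>R w i t + Q' t *\<^sub>R w j t" for t
  proof -
    have "vel \<kappa> t = P' t *\<^sub>R (\<Sum>l\<in>UNIV. (axis i 1 :: real^'m) $ l *\<^sub>R w l t)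
        + Q' t *\<^sub>R (\<Sum>l\<in>UNIV. (axis j 1 :: real^'m) $ l *\<^sub>R w l t)"
      by (simp add: vel_def \<kappa>_def scaleR_sum_right sum.distrib scaleR_left_distrib)
    then show ?thesis
      by (simp add: vel_axis)
  qed
  \<comment> \<open>The circle is \<open>g\<close>; its velocity is the input velocity \<open>vel \<kappa>\<close> plus the slow term \<open>f\<close>,
     which comes from the motion of the directions \<open>w i\<close> and \<open>w j\<close>.\<close>
  define f where "f = (\<lambda>t. P t *\<^sub>R w'i t + Q t *\<^sub>R w'j t)"
  define g where "g = (\<lambda>t. P t *\<^sub>R w i t + Q t *\<^sub>R w j t)"
  have comb_bound: "norm (P t *\<^sub>R x + Q t *\<^sub>R y) \<le> 2 * A / N" if "norm x \<le> A" "norm y \<le> A" for t x y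
  proof -
    have "norm (P t *\<^sub>R x) \<le> 1 / N * A" "norm (Q t *\<^sub>R y) \<le> 1 / N * A"
      unfolding norm_scaleR using that PQ[of t] N by (intro mult_mono; simp)+
    then show ?thesis
      using norm_triangle_ineq[of "P t *\<^sub>R x" "Q t *\<^sub>R y"] by simp
  qed
  have f: "norm (f t) \<le> 2 * A / N" and g: "norm (g t) \<le> 2 * A / N" if "t \<in> {0..T}" for t
    unfolding f_def g_def using A[OF that] by (auto intro: comb_bound)
  have f_cont: "continuous_on {0..T} f" and g_cont: "continuous_on {0..T} g"
    unfolding f_def g_def
    by (intro continuous_intros PQ'_cont continuous_on_subset[OF w'_cont(1)]
        continuous_on_subset[OF w'_cont(2)] continuous_on_subset[OF w_cont] subset_UNIV)+
  have g': "(g has_vector_derivative vel \<kappa> t + f t) (at t within {0..T})" for t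
  proof -
    have "(g has_vector_derivative (P t *\<^sub>R w'i t + P' t *\<^sub>R w i t) + (Q t *\<^sub>R w'j t + Q' t *\<^sub>R w j t))
        (at t within {0..T})"
      unfolding g_def
      by (intro has_vector_derivative_add has_vector_derivative_scaleR
          has_vector_derivative_at_within[OF w'(1)] has_vector_derivative_at_within[OF w'(2)]
          has_field_derivative_at_within[OF P'] has_field_derivative_at_within[OF Q'])
    then show ?thesis
      by (simp add: vel_\<kappa> f_def algebra_simps)
  qed
  define r where "r = pos \<kappa> T"
  have r: "norm r \<le> (4 * A + 2 * A * T) / N"
  proof -
    have "((\<lambda>t. pos \<kappa> t - g t) has_vector_derivative vel \<kappa> t - (vel \<kappa> t + f t)) (at t within {0..T})"
      if "t \<in> {0..T}" for t
      by (rule has_vector_derivative_diff[OF pos_deriv[OF \<kappa> that] g'])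
    from fundamental_theorem_of_calculus[OF _ this] T_pos
    have "((\<lambda>t. - f t) has_integral (pos \<kappa> T - g T - (pos \<kappa> 0 - g 0))) {0..T}"
      by simp
    from integral_unique[OF this] have "r = g T - g 0 - integral {0..T} f"
      by (simp add: r_def algebra_simps)
    moreover have "norm (integral {0..T} f) \<le> 2 * A / N * (T - 0)"
      using T_pos f_cont f by (intro integral_bound) auto
    moreover have "norm (g T) \<le> 2 * A / N" "norm (g 0) \<le> 2 * A / N"
      using T_pos by (intro g; simp)+
    ultimately have "norm r \<le> 2 * A / N + 2 * A / N + 2 * A / N * T"
      using norm_triangle_ineq4[of "g T - g 0" "integral {0..T} f"] norm_triangle_ineq4[of "g T" "g 0"]
      by simp
    then show ?thesis
      using N by (simp add: field_simps)
  qed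
  \<comment> \<open>Subtracting an input that leads to \<open>r\<close> closes the loop; \<open>e\<close> is the deviation of the closed
     loop from the circle.\<close>
  define k where "k = (\<lambda>t. \<kappa> t + (-1) *\<^sub>R \<rho> r t)"
  define e where "e = (\<lambda>t. pos k t - g t)"
  define e' where "e' = (\<lambda>t. - f t - vel (\<rho> r) t)"
  have k: "continuous_on UNIV k"
    unfolding k_def by (intro continuous_intros \<kappa> \<rho>)
  have pos_k: "pos k T = 0"
    unfolding k_def using pos_linear[OF \<kappa> \<rho>(2)[of r], of "-1" T] by (simp add: r_def \<rho>)
  have vel_k: "vel k t = (vel \<kappa> t + f t) + e' t" for t
    unfolding k_def vel_linear e'_def by simp
  have e'_deriv: "(e has_vector_derivative e' t) (at t within {0..T})" if "t \<in> {0..T}" for t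
    using has_vector_derivative_diff[OF pos_deriv[OF k that] g'[of t]]
    unfolding e_def vel_k by simp
  have e'_cont: "continuous_on {0..T} e'"
    unfolding e'_def by (intro continuous_intros f_cont vel_cont \<rho>)
  have e'_small: "norm (e' t) \<le> C1 / N" if t: "t \<in> {0..T}" for t
  proof -
    have "norm (e' t) \<le> norm (f t) + norm (vel (\<rho> r) t)"
      unfolding e'_def using norm_triangle_ineq4[of "- f t" "vel (\<rho> r) t"] by simp
    also have "\<dots> \<le> 2 * A / N + Cr * ((4 * A + 2 * A * T) / N)"
      using f[OF t] \<rho>(4)[OF t, of r] mult_left_mono[OF r \<rho>(1)] by linarith
    finally show ?thesis
      by (simp only: C1_def add_divide_distrib[of "2 * A" "Cr * _"] times_divide_eq_right)
  qed
  have e_small: "norm (e t) \<le> C / N" if t: "t \<in> {0..T}" for t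
  proof -
    have sub: "{0..t} \<subseteq> {0..T}" using t by auto
    have "(e has_vector_derivative e' x) (at x within {0..t})" if "x \<in> {0..t}" for x
      using has_vector_derivative_within_subset[OF e'_deriv sub] that sub by auto
    from fundamental_theorem_of_calculus[OF _ this] t
    have "integral {0..t} e' = e t - e 0"
      by (simp add: integral_unique)
    moreover have "norm (integral {0..t} e') \<le> C1 / N * (t - 0)"
      using t sub by (intro integral_bound continuous_on_subset[OF e'_cont] e'_small) auto
    moreover have "norm (e 0) \<le> 2 * A / N"
      unfolding e_def using g[of 0] T_pos by simp
    moreover have "C1 / N * t \<le> C1 / N * T"
      using t \<open>C1 \<ge> 0\<close> N by (intro mult_left_mono) auto
    moreover have "norm (e t) \<le> norm (e t - e 0) + norm (e 0)"
      using norm_triangle_ineq[of "e t - e 0" "e 0"] by simp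
    ultimately have "norm (e t) \<le> 2 * A / N + C1 / N * T"
      by simp
    also have "\<dots> \<le> C / N"
      using \<open>C1 \<ge> 0\<close> N by (simp add: C_def divide_simps)
    finally show ?thesis .
  qed
  have C_ge: "2 * A / N \<le> C / N" "C1 / N \<le> C / N"
    using \<open>C1 \<ge> 0\<close> \<open>A \<ge> 0\<close> T_pos N by (auto simp: C_def intro!: divide_right_mono)
  have "\<bar>integral {0..T} (\<lambda>t. \<omega> ((vel \<kappa> t + f t) + e' t) (g t + e t))
      - integral {0..T} (\<lambda>t. \<omega> (vel \<kappa> t + f t) (g t))\<bar> \<le> K * (C / N)\<^sup>2 * (2 + 3 * T)"
  proof (rule area_perturbation[OF bilinear K(2,1)])
    show "continuous_on {0..T} (\<lambda>t. vel \<kappa> t + f t)"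
      by (intro continuous_intros vel_cont \<kappa> f_cont)
    show "norm (g t) \<le> C / N" "norm (e' t) \<le> C / N" if "t \<in> {0..T}" for t
      using g[OF that] e'_small[OF that] C_ge by linarith+
  qed (use T_pos g' e'_deriv e'_cont e_small in auto)
  also have "(\<lambda>t. \<omega> ((vel \<kappa> t + f t) + e' t) (g t + e t)) = (\<lambda>t. \<omega> (vel k t) (pos k t))"
    by (simp add: vel_k e_def)
  also have "integral {0..T} (\<lambda>t. \<omega> (vel \<kappa> t + f t) (g t)) = - \<sigma> * I + integral {0..T} (\<lambda>t. \<omega> (f t) (g t))"
  proof -
    have skew: "\<omega> b a = - \<omega> a b" for a b
      using alternating[of "a + b"] alternating[of a] alternating[of b]
      by (simp add: add_left add_right)
    have "\<omega> (vel \<kappa> t + f t) (g t) = - \<sigma> * \<omega> (w i t) (w j t) + \<omega> (f t) (g t)" for t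
    proof -
      have "\<omega> (vel \<kappa> t) (g t) = (P' t * Q t - Q' t * P t) * \<omega> (w i t) (w j t)"
        unfolding vel_\<kappa> g_def
        by (simp add: add_left add_right scaleR_left scaleR_right alternating skew[of "w j t" "w i t"]
            algebra_simps)
      then show ?thesis
        by (simp add: wronskian add_left)
    qed
    then have "integral {0..T} (\<lambda>t. \<omega> (vel \<kappa> t + f t) (g t))
        = integral {0..T} (\<lambda>t. - \<sigma> * \<omega> (w i t) (w j t) + \<omega> (f t) (g t))"
      by simp
    also have "\<dots> = integral {0..T} (\<lambda>t. - \<sigma> * \<omega> (w i t) (w j t)) + integral {0..T} (\<lambda>t. \<omega> (f t) (g t))"
      by (intro integral_add integrable_continuous_real continuous_intros continuous_on f_cont g_cont
          continuous_on_subset[OF w_cont] subset_UNIV)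
    also have "integral {0..T} (\<lambda>t. - \<sigma> * \<omega> (w i t) (w j t)) = - \<sigma> * I"
      unfolding I_def by (rule integral_mult_right)
    finally show ?thesis .
  qed
  finally have 1: "\<bar>area k - (- \<sigma> * I + integral {0..T} (\<lambda>t. \<omega> (f t) (g t)))\<bar> \<le> K * (C / N)\<^sup>2 * (2 + 3 * T)"
    by (simp add: area_def)
  have 2: "\<bar>integral {0..T} (\<lambda>t. \<omega> (f t) (g t))\<bar> \<le> K * (C / N)\<^sup>2 * (T - 0)"
  proof (subst real_norm_def[symmetric], rule integral_bound)
    show "continuous_on {0..T} (\<lambda>t. \<omega> (f t) (g t))"
      by (intro continuous_on f_cont g_cont)
    fix t assume t: "t \<in> {0..T}"
    have "norm (f t) * norm (g t) \<le> (C / N) * (C / N)"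
      using f[OF t] g[OF t] C_ge \<open>C \<ge> 0\<close> N by (intro mult_mono) auto
    from order_trans[OF K(2) mult_left_mono[OF this K(1)]]
    show "norm (\<omega> (f t) (g t)) \<le> K * (C / N)\<^sup>2"
      by (simp only: real_norm_def power2_eq_square)
  qed (use T_pos in simp)
  have "\<bar>area k - s * \<bar>I\<bar>\<bar> \<le> K * (C / N)\<^sup>2 * (2 + 4 * T)"
    using 1 2 \<sigma>(2) by (simp add: algebra_simps)
  also note N2
  finally have "\<bar>area k - s * \<bar>I\<bar>\<bar> < \<bar>I\<bar>" .
  moreover have "s = 1 \<or> s = -1"
    using s by linarith
  ultimately have "s * area k > 0"
    by auto
  with k pos_k show thesis
    by (rule that)
qed

text \<open>Along the line \<open>u0 + s k\<close>, with \<open>k\<close> a loop, the horizontal endpoint is fixed and the vertical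
  endpoint is a quadratic polynomial in \<open>s\<close> whose leading coefficient is half the area of \<open>k\<close>. In
  the first case of \<open>vertical\<close> the input \<open>\<beta>\<close> does not move the horizontal coordinate, and the
  polynomial is affine and not constant. In the second the leading coefficient may be given the sign
  of the required change, so that the quadratic equation has a real root.\<close>

lemma steer:
  fixes c :: "'m \<Rightarrow> real \<Rightarrow> real"
  assumes c_cont: "\<And>j. continuous_on UNIV (c j)"
    and vertical: "(\<exists>\<beta>. (\<forall>t. vel (\<lambda>_. \<beta>) t = 0) \<and> integral {0..T} (\<lambda>t. \<Sum>j\<in>UNIV. \<beta> $ j * c j t) \<noteq> 0) \<or>
      (\<forall>s. \<bar>s\<bar> = 1 \<longrightarrow> (\<exists>k. continuous_on UNIV k \<and> pos k T = 0 \<and> s * area k > 0))"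
  obtains u p z where "continuous_on UNIV u" "p 0 = p0" "p T = p1" "z 0 = z0" "z T = z1"
    "\<And>t. t \<in> {0..T} \<Longrightarrow> (p has_vector_derivative (\<Sum>j\<in>UNIV. u t $ j *\<^sub>R w j t)) (at t within {0..T})"
    "\<And>t. t \<in> {0..T} \<Longrightarrow> (z has_vector_derivative
       (\<Sum>j\<in>UNIV. u t $ j * (c j t + \<omega> (w j t) (p t) / 2))) (at t within {0..T})"
proof -
  define H where "H = (\<lambda>u t. (\<Sum>j\<in>UNIV. u t $ j * c j t) + \<omega> (vel u t) (p0 + pos u t) / 2)"
  define F where "F = (\<lambda>u. integral {0..T} (H u))"
  have c_sum_cont: "continuous_on {0..T} (\<lambda>t. \<Sum>j\<in>UNIV. u t $ j * c j t)" if "continuous_on UNIV u" for u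
    by (intro continuous_intros continuous_on_subset[OF c_cont] continuous_on_subset[OF that] subset_UNIV)
  have H_cont: "continuous_on {0..T} (H u)" if "continuous_on UNIV u" for u
    unfolding H_def by (intro continuous_intros continuous_on c_sum_cont vel_cont pos_cont that) simp
  have F_quadratic: "F (\<lambda>t. u t + s *\<^sub>R k t) = F u
      + s * integral {0..T} (\<lambda>t. (\<Sum>j\<in>UNIV. k t $ j * c j t) + (\<omega> (vel k t) (p0 + pos u t) + \<omega> (vel u t) (pos k t)) / 2)
      + s\<^sup>2 * (area k / 2)"
    if uk: "continuous_on UNIV u" "continuous_on UNIV k" for u k s
  proof -
    define l where "l = (\<lambda>t. (\<Sum>j\<in>UNIV. k t $ j * c j t) + (\<omega> (vel k t) (p0 + pos u t) + \<omega> (vel u t) (pos k t)) / 2)"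
    have H: "H (\<lambda>t. u t + s *\<^sub>R k t) t = H u t + s * l t + s\<^sup>2 * (\<omega> (vel k t) (pos k t) / 2)" for t
      unfolding H_def l_def vel_linear pos_linear[OF uk]
      by (simp add: add_left add_right scaleR_left scaleR_right distrib_right sum.distrib
          sum_distrib_left mult.assoc power2_eq_square field_simps)
    have l_cont: "continuous_on {0..T} l" and k_cont: "continuous_on {0..T} (\<lambda>t. \<omega> (vel k t) (pos k t) / 2)"
      unfolding l_def
      by (intro continuous_intros continuous_on c_sum_cont vel_cont pos_cont uk; simp)+
    have int: "H u integrable_on {0..T}" "(\<lambda>t. s * l t) integrable_on {0..T}"
      "(\<lambda>t. s\<^sup>2 * (\<omega> (vel k t) (pos k t) / 2)) integrable_on {0..T}"
      by (intro integrable_continuous_real H_cont uk continuous_on_mult_left l_cont k_cont)+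
    have "F (\<lambda>t. u t + s *\<^sub>R k t)
        = integral {0..T} (\<lambda>t. H u t + s * l t + s\<^sup>2 * (\<omega> (vel k t) (pos k t) / 2))"
      unfolding F_def by (rule integral_cong) (rule H)
    also have "\<dots> = integral {0..T} (H u) + integral {0..T} (\<lambda>t. s * l t)
        + integral {0..T} (\<lambda>t. s\<^sup>2 * (\<omega> (vel k t) (pos k t) / 2))"
      by (simp only: integral_add integrable_add int)
    also have "integral {0..T} (\<lambda>t. s * l t) = s * integral {0..T} l"
      by (rule integral_mult_right)
    also have "integral {0..T} (\<lambda>t. s\<^sup>2 * (\<omega> (vel k t) (pos k t) / 2)) = s\<^sup>2 * (area k / 2)"
      unfolding area_def by simp
    finally show ?thesis
      by (simp add: F_def l_def)
  qed
  obtain u0 where u0: "continuous_on UNIV u0" "pos u0 T = p1 - p0"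
    using pos_onto by blast
  define d where "d = z1 - z0 - F u0"
  have "\<exists>k s. continuous_on UNIV k \<and> pos k T = 0 \<and> F (\<lambda>t. u0 t + s *\<^sub>R k t) = z1 - z0"
    using vertical
  proof (elim disjE exE conjE)
    fix \<beta> :: "real^'m"
    assume \<beta>: "\<forall>t. vel (\<lambda>_. \<beta>) t = 0" and nz: "integral {0..T} (\<lambda>t. \<Sum>j\<in>UNIV. \<beta> $ j * c j t) \<noteq> 0"
    have "vel (\<lambda>_. \<beta>) = (\<lambda>t. 0)"
      using \<beta> by (simp add: fun_eq_iff)
    then have pos: "pos (\<lambda>_. \<beta>) t = 0" for t
      by (simp add: pos_def)
    show ?thesis
      using F_quadratic[OF u0(1) continuous_on_const[of UNIV \<beta>],
          of "d / integral {0..T} (\<lambda>t. \<Sum>j\<in>UNIV. \<beta> $ j * c j t)"] pos nz \<beta>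
      by (intro exI[of _ "\<lambda>_. \<beta>"] exI[of _ "d / integral {0..T} (\<lambda>t. \<Sum>j\<in>UNIV. \<beta> $ j * c j t)"])
        (simp add: zero_left zero_right area_def d_def)
  next
    assume *: "\<forall>s. \<bar>s\<bar> = 1 \<longrightarrow> (\<exists>k. continuous_on UNIV k \<and> pos k T = 0 \<and> s * area k > 0)"
    define \<epsilon> :: real where "\<epsilon> = (if d \<ge> 0 then 1 else -1)"
    have "\<bar>\<epsilon>\<bar> = 1" by (simp add: \<epsilon>_def)
    then obtain k where k: "continuous_on UNIV k" "pos k T = 0" "\<epsilon> * area k > 0"
      using * by blast
    define l where "l = integral {0..T} (\<lambda>t. (\<Sum>j\<in>UNIV. k t $ j * c j t)
        + (\<omega> (vel k t) (p0 + pos u0 t) + \<omega> (vel u0 t) (pos k t)) / 2)"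
    define a where "a = area k / 2"
    have "a \<noteq> 0" "a * d \<ge> 0"
      using k(3) by (auto simp: a_def \<epsilon>_def zero_le_mult_iff split: if_splits)
    then have "discrim a l (- d) \<ge> 0"
      by (simp add: discrim_def)
    then obtain s where "a * s\<^sup>2 + l * s + (- d) = 0"
      using discriminant_nonneg[OF \<open>a \<noteq> 0\<close>] by blast
    then have "F u0 + s * l + s\<^sup>2 * a = z1 - z0"
      by (simp add: d_def algebra_simps)
    then have "F (\<lambda>t. u0 t + s *\<^sub>R k t) = z1 - z0"
      unfolding F_quadratic[OF u0(1) k(1)] l_def a_def .
    then show ?thesis
      using k by blast
  qed
  then obtain k s where k: "continuous_on UNIV k" "pos k T = 0"
      "F (\<lambda>t. u0 t + s *\<^sub>R k t) = z1 - z0"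
    by blast
  define u where "u = (\<lambda>t. u0 t + s *\<^sub>R k t)"
  have u: "continuous_on UNIV u" "pos u T = p1 - p0" "F u = z1 - z0"
    using k u0 pos_linear[OF u0(1) k(1), of s T] by (auto simp: u_def intro!: continuous_intros)
  show thesis
  proof
    show "continuous_on UNIV u" by fact
    show "p0 + pos u 0 = p0" "p0 + pos u T = p1"
      using u by simp_all
    show "z0 + integral {0..0} (H u) = z0" "z0 + integral {0..T} (H u) = z1"
      using u(3) by (simp_all add: F_def)
    fix t assume t: "t \<in> {0..T}"
    show "((\<lambda>t. p0 + pos u t) has_vector_derivative (\<Sum>j\<in>UNIV. u t $ j *\<^sub>R w j t)) (at t within {0..T})"
      using has_vector_derivative_add[OF has_vector_derivative_const pos_deriv[OF u(1) t], of p0]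
      by (simp add: vel_def)
    have "H u t = (\<Sum>j\<in>UNIV. u t $ j * (c j t + \<omega> (w j t) (p0 + pos u t) / 2))"
      unfolding H_def vel_def
      by (simp add: sum_left scaleR_left distrib_left sum.distrib sum_divide_distrib)
    then show "((\<lambda>t. z0 + integral {0..t} (H u)) has_vector_derivative
        (\<Sum>j\<in>UNIV. u t $ j * (c j t + \<omega> (w j t) (p0 + pos u t) / 2))) (at t within {0..T})"
      using has_vector_derivative_add[OF has_vector_derivative_const
          integral_has_vector_derivative[OF H_cont[OF u(1)] t], of z0] by simp
  qed
qed

end

section \<open>Trajectories in exponential coordinates\<close>

text \<open>A continuously differentiable curve on a compact interval is Lipschitz.\<close>

lemma absolutely_continuous_curve_if_C1:
  assumes deriv: "\<And>t. t \<in> {a..b} \<Longrightarrow> (\<gamma> has_vector_derivative \<gamma>' t) (at t within {a..b})"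
    and cont: "continuous_on {a..b} \<gamma>'"
  shows "absolutely_continuous_curve a b \<gamma>"
proof -
  obtain C0 where "\<forall>t\<in>{a..b}. norm (\<gamma>' t) \<le> C0"
    using compact_imp_bounded[OF compact_continuous_image[OF cont compact_Icc]]
    by (auto simp: bounded_iff)
  then have C: "norm (\<gamma>' t) \<le> \<bar>C0\<bar> + 1" if "t \<in> {a..b}" for t
    using that by (smt (verit))
  define C where "C = \<bar>C0\<bar> + 1"
  have "C > 0" by (simp add: C_def)
  have lip: "norm (\<gamma> d - \<gamma> c) \<le> C * (d - c)" if "c \<le> d" "{c..d} \<subseteq> {a..b}" for c d
  proof -
    have "(\<gamma> has_vector_derivative \<gamma>' x) (at x within {c..d})" if "x \<in> {c..d}" for x
      using has_vector_derivative_within_subset[OF deriv] that \<open>{c..d} \<subseteq> {a..b}\<close> by blast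
    from integral_unique[OF fundamental_theorem_of_calculus[OF \<open>c \<le> d\<close> this]]
    have "integral {c..d} \<gamma>' = \<gamma> d - \<gamma> c" .
    moreover have "norm (integral {c..d} \<gamma>') \<le> C * (d - c)"
      using that C unfolding C_def by (intro integral_bound continuous_on_subset[OF cont]) auto
    ultimately show ?thesis by simp
  qed
  show ?thesis
    unfolding absolutely_continuous_curve_def
  proof (intro allI impI)
    fix \<epsilon> :: real assume "\<epsilon> > 0"
    have "(\<Sum>I\<in>D. norm (\<gamma> (Sup I) - \<gamma> (Inf I))) < \<epsilon>"
      if D: "D division_of \<Union>D \<and> \<Union>D \<subseteq> {a..b} \<and> (\<Sum>I\<in>D. Sup I - Inf I) < \<epsilon> / C" for D
    proof -
      have "norm (\<gamma> (Sup I) - \<gamma> (Inf I)) \<le> C * (Sup I - Inf I)" if "I \<in> D" for I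
      proof -
        have "D division_of \<Union>D" using D by blast
        from division_ofD(2-4)[OF this \<open>I \<in> D\<close>] obtain c d where I: "I = {c..d}" "I \<noteq> {}" "I \<subseteq> \<Union>D"
          by auto
        then have "{c..d} \<subseteq> {a..b}"
          using D by blast
        then show ?thesis
          using I lip[of c d] by simp
      qed
      then have "(\<Sum>I\<in>D. norm (\<gamma> (Sup I) - \<gamma> (Inf I))) \<le> (\<Sum>I\<in>D. C * (Sup I - Inf I))"
        by (rule sum_mono)
      also have "\<dots> < \<epsilon>"
        unfolding sum_distrib_left[symmetric] using D \<open>C > 0\<close> by (simp add: field_simps)
      finally show ?thesis .
    qed
    then show "\<exists>\<delta>>0. \<forall>D. D division_of \<Union>D \<and> \<Union>D \<subseteq> {a..b} \<and> (\<Sum>I\<in>D. Sup I - Inf I) < \<delta> \<longrightarrow>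
        (\<Sum>I\<in>D. norm (\<gamma> (Sup I) - \<gamma> (Inf I))) < \<epsilon>"
      using \<open>\<epsilon> > 0\<close> \<open>C > 0\<close> by (intro exI[of _ "\<epsilon> / C"]) simp
  qed
qed

lemma admissible_input_if_continuous:
  assumes "continuous_on UNIV u"
  shows "admissible_input u"
  unfolding admissible_input_def
proof (intro conjI allI)
  show "u \<in> borel_measurable lebesgue"
    using continuous_imp_measurable_on_sets_lebesgue[OF assms] by simp
  show "bounded (u ` {a..b})" for a b
    by (rule compact_imp_bounded[OF compact_continuous_image[OF continuous_on_subset[OF assms] compact_Icc]]) simp
qed

lemma continuous_on_rfield: "continuous_on S (rfield v)"
  by (rule has_derivative_continuous_on[OF has_derivative_at_withinI[OF rfield_has_derivative]])

lemma linear_hexp_deriv: "linear (hexp_deriv v)"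
  by (cases v) (auto intro!: linearI simp: hexp_deriv_def algebra_simps inner_add_left
      inner_add_right add_divide_distrib)

text \<open>Variation of constants on the group. Writing \<open>\<gamma>\<close> as the flow of \<open>X\<close> applied to a moving point
  removes the drift, and in exponential coordinates the moving point \<open>\<eta>\<close> obeys a driftless system
  whose control fields are the transported vectors \<open>L (- t) (b j)\<close>.\<close>

lemma trajectory_if_flow_coordinates:
  fixes b :: "'m::finite \<Rightarrow> 'n::finite heis"
  assumes flow: "heis_flow L M" and X: "\<And>v. X (hexp v) = hexp_deriv v (M v)"
    and X_cont: "continuous_on UNIV X" and u: "continuous_on UNIV u"
    and \<eta>: "\<And>t. t \<in> {0..T} \<Longrightarrow> (\<eta> has_vector_derivative
      (\<Sum>j\<in>UNIV. u t $ j *\<^sub>R (L (- t) (b j) + (1/2) *\<^sub>R brk (L (- t) (b j)) (\<eta> t)))) (at t within {0..T})"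
  shows "trajectory X (\<lambda>j. rfield (b j)) u T (\<lambda>t. hexp (L t (\<eta> t)))"
proof -
  interpret heis_flow L M by fact
  define \<gamma> where "\<gamma> = (\<lambda>t. hexp (L t (\<eta> t)))"
  define \<gamma>' where "\<gamma>' = (\<lambda>t. X (\<gamma> t) + (\<Sum>j\<in>UNIV. u t $ j *\<^sub>R rfield (b j) (\<gamma> t)))"
  have \<gamma>': "(\<gamma> has_vector_derivative \<gamma>' t) (at t within {0..T})" if t: "t \<in> {0..T}" for t
  proof -
    define \<zeta> where "\<zeta> = L t (\<eta> t)"
    have "L t (L (- t) (b j) + (1/2) *\<^sub>R brk (L (- t) (b j)) (\<eta> t)) = b j + (1/2) *\<^sub>R brk (b j) \<zeta>" for j
      by (simp add: \<zeta>_def linear_add[OF L_linear] linear_scale[OF L_linear] L_brk)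
    then have "((\<lambda>t. L t (\<eta> t)) has_vector_derivative
        M \<zeta> + (\<Sum>j\<in>UNIV. u t $ j *\<^sub>R (b j + (1/2) *\<^sub>R brk (b j) \<zeta>))) (at t within {0..T})"
      using L_moving_deriv[OF \<eta>[OF t]]
      by (simp add: \<zeta>_def linear_sum[OF L_linear] linear_scale[OF L_linear])
    from vector_derivative_diff_chain_within[OF this hexp_has_derivative]
    have "(\<gamma> has_vector_derivative
        hexp_deriv \<zeta> (M \<zeta> + (\<Sum>j\<in>UNIV. u t $ j *\<^sub>R (b j + (1/2) *\<^sub>R brk (b j) \<zeta>)))) (at t within {0..T})"
      unfolding \<gamma>_def \<zeta>_def o_def .
    also have "hexp_deriv \<zeta> (M \<zeta> + (\<Sum>j\<in>UNIV. u t $ j *\<^sub>R (b j + (1/2) *\<^sub>R brk (b j) \<zeta>)))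
        = X (hexp \<zeta>) + (\<Sum>j\<in>UNIV. u t $ j *\<^sub>R rfield (b j) (hexp \<zeta>))"
      unfolding X rfield_hexp
      by (simp only: linear_add[OF linear_hexp_deriv] linear_sum[OF linear_hexp_deriv]
          linear_scale[OF linear_hexp_deriv])
    finally show ?thesis
      by (simp only: \<gamma>'_def \<gamma>_def \<zeta>_def)
  qed
  have \<gamma>_cont: "continuous_on {0..T} \<gamma>"
    using \<gamma>' by (rule continuous_on_vector_derivative)
  have "continuous_on {0..T} \<gamma>'"
    unfolding \<gamma>'_def
    by (intro continuous_intros continuous_on_compose2[OF X_cont \<gamma>_cont]
        continuous_on_compose2[OF continuous_on_rfield[of UNIV] \<gamma>_cont] continuous_on_subset[OF u] subset_UNIV)
  with \<gamma>' have "absolutely_continuous_curve 0 T \<gamma>"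
    by (rule absolutely_continuous_curve_if_C1)
  then show ?thesis
    using \<gamma>' unfolding trajectory_def \<gamma>'_def \<gamma>_def by (intro conjI AE_I2 impI)
qed

section \<open>Controllability\<close>

theorem theorem7:
  fixes X :: "'n::finite vfield" and B :: "'m::finite \<Rightarrow> 'n vfield" and Z :: "'n vfield"
  assumes "linear_system X B"
    and "generates_center Z"
    and "rank_condition X B"
    and "Z \<in> lie_generated (range B)"
  shows "\<forall>T>0. controllable_in_exact_time X B T"
proof (intro allI impI)
  fix T :: real assume T: "T > 0"
  have lin: "linear_field X" and "\<forall>j. \<exists>v. B j = rfield v"
    using assms(1) by (simp_all add: linear_system_def right_invariant_iff_rfield)
  then obtain b where B: "B = (\<lambda>j. rfield (b j))"
    by (metis ext)
  obtain L M where flow: "heis_flow L M" and X: "\<And>v. X (hexp v) = hexp_deriv v (M v)"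
    using linear_field_imp_heis_flow[OF lin] by blast
  interpret heis_flow L M by fact
  have X_cont: "continuous_on UNIV X"
    using lin unfolding linear_field_def smooth_map_def by (metis Ck_map.simps(1))
  define w where "w = (\<lambda>j t. horiz (L (- t) (b j)))"
  define c where "c = (\<lambda>j t. snd (snd (L (- t) (b j))))"
  have L_cont: "continuous_on S (\<lambda>t. L (- t) v)" for S v
    by (rule continuous_on_compose2[OF continuous_on_L[of UNIV v]]) (auto intro!: continuous_intros)
  have horiz_bl: "bounded_linear horiz"
    using linear_horiz by (simp add: linear_conv_bounded_linear)
  have wv_cont: "continuous_on S (\<lambda>t. horiz (L (- t) v))" for S v
    by (rule bounded_linear.continuous_on[OF horiz_bl L_cont])
  have c_cont: "continuous_on UNIV (c j)" for j
    unfolding c_def by (intro continuous_intros L_cont)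
  have w': "(w j has_vector_derivative horiz (L (- t) (- M (b j)))) (at t)" for j t
  proof -
    have "((\<lambda>t. - t) has_vector_derivative - 1) (at t)"
      by (auto intro!: derivative_eq_intros)
    from vector_diff_chain_at[OF this L_deriv[of "b j" "- t"]]
    have "((\<lambda>t. L (- t) (b j)) has_vector_derivative L (- t) (- M (b j))) (at t)"
      by (simp add: o_def M_L linear_neg[OF L_linear])
    from bounded_linear.has_vector_derivative[OF horiz_bl this] show ?thesis
      unfolding w_def .
  qed
  interpret S: steering symplectic w T
  proof (rule steering.intro)
    show "bounded_bilinear (symplectic :: (real^'n) \<times> (real^'n) \<Rightarrow> _)"
      by (rule bounded_bilinear_symplectic)
    show "symplectic p p = 0" for p :: "(real^'n) \<times> (real^'n)"
      by (simp add: symplectic_def inner_commute)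
    show "continuous_on UNIV (w j)" for j
      unfolding w_def by (rule wv_cont)
    fix \<theta> :: "(real^'n) \<times> (real^'n)"
    assume "\<And>j t. t \<in> {0..T} \<Longrightarrow> \<theta> \<bullet> w j t = 0"
    from kalman_observability[OF T rank_condition_imp_spanning[OF flow X assms(3)[unfolded B]] this[unfolded w_def]]
    show "\<theta> = 0" .
  qed fact
  have factor_cont: "continuous_on {0..T} (\<lambda>t. factor (- t))"
    by (rule continuous_on_compose2[OF continuous_on_factor[of UNIV]]) (auto intro!: continuous_intros)
  have factor_int: "integral {0..T} (\<lambda>t. factor (- t)) > 0"
    using integral_less_real[OF continuous_on_const factor_cont, of 0] T factor_pos by simp
  have vertical: "(\<exists>\<beta>. (\<forall>t. S.vel (\<lambda>_. \<beta>) t = 0) \<and> integral {0..T} (\<lambda>t. \<Sum>j\<in>UNIV. \<beta> $ j * c j t) \<noteq> 0) \<or>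
      (\<forall>s. \<bar>s\<bar> = 1 \<longrightarrow> (\<exists>k. continuous_on UNIV k \<and> S.pos k T = 0 \<and> s * S.area k > 0))"
    using assms(2) assms(4)[unfolded B]
  proof (cases rule: center_generated_cases)
    \<comment> \<open>Transport by \<open>L (- t)\<close> only rescales the bracket of two fields, so the area element of the
       two directions keeps its sign in time.\<close>
    case (area i j)
    have "integral {0..T} (\<lambda>t. symplectic (w i t) (w j t))
        = integral {0..T} (\<lambda>t. factor (- t)) * symplectic (horiz (b i)) (horiz (b j))"
      by (simp add: w_def symplectic_L)
    then have nz: "integral {0..T} (\<lambda>t. symplectic (w i t) (w j t)) \<noteq> 0"
      using factor_int area by simp
    show ?thesis
      using S.loops_of_both_signs[OF w' w' wv_cont wv_cont nz] by metis
  next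
    \<comment> \<open>The constant input \<open>\<beta>\<close> moves along the center only.\<close>
    case (direct \<beta> r)
    have sum: "(\<Sum>j\<in>UNIV. \<beta> j *\<^sub>R L (- t) (b j)) = vert (factor (- t) * r)" for t
      using arg_cong[OF direct(2), of "L (- t)"]
      by (simp add: linear_sum[OF L_linear] linear_scale[OF L_linear] L_vert)
    have "(\<Sum>j\<in>UNIV. \<beta> j *\<^sub>R w j t) = 0" for t
      using arg_cong[OF sum, of horiz t]
      by (simp add: linear_sum[OF linear_horiz] linear_scale[OF linear_horiz] w_def)
    moreover have "(\<Sum>j\<in>UNIV. \<beta> j * c j t) = factor (- t) * r" for t
      using arg_cong[OF sum, of "\<lambda>v. snd (snd v)" t] by (simp add: c_def vert_def snd_sum)
    ultimately show ?thesis
      using factor_int direct(1) by (intro disjI1 exI[of _ "\<chi> j. \<beta> j"]) (simp add: S.vel_def)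
  qed
  show "controllable_in_exact_time X B T"
    unfolding controllable_in_exact_time_def
  proof (intro allI)
    fix g h :: "'n heis"
    define v0 where "v0 = hlog g"
    define v1 where "v1 = L (- T) (hlog h)"
    obtain u p z where u: "continuous_on UNIV u"
      and ends: "p 0 = horiz v0" "p T = horiz v1" "z 0 = snd (snd v0)" "z T = snd (snd v1)"
      and p': "\<And>t. t \<in> {0..T} \<Longrightarrow> (p has_vector_derivative (\<Sum>j\<in>UNIV. u t $ j *\<^sub>R w j t)) (at t within {0..T})"
      and z': "\<And>t. t \<in> {0..T} \<Longrightarrow> (z has_vector_derivative
        (\<Sum>j\<in>UNIV. u t $ j * (c j t + symplectic (w j t) (p t) / 2))) (at t within {0..T})"
      by (rule S.steer[OF c_cont vertical, where ?p0.0 = "horiz v0" and ?p1.0 = "horiz v1"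
            and ?z0.0 = "snd (snd v0)" and ?z1.0 = "snd (snd v1)"]) blast
    define \<eta> where "\<eta> = (\<lambda>t. (fst (p t), snd (p t), z t))"
    have \<eta>_ends: "\<eta> 0 = v0" "\<eta> T = v1"
      by (simp_all add: \<eta>_def ends horiz_def)
    have "(\<eta> has_vector_derivative
        (\<Sum>j\<in>UNIV. u t $ j *\<^sub>R (L (- t) (b j) + (1/2) *\<^sub>R brk (L (- t) (b j)) (\<eta> t)))) (at t within {0..T})"
      if t: "t \<in> {0..T}" for t
    proof -
      have brk: "brk v (\<eta> t) = vert (symplectic (horiz v) (p t))" for v
        by (simp add: brk_def \<eta>_def horiz_def[of "(_, _, _)"])
      have "(\<eta> has_vector_derivative (fst (\<Sum>j\<in>UNIV. u t $ j *\<^sub>R w j t), snd (\<Sum>j\<in>UNIV. u t $ j *\<^sub>R w j t),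
          \<Sum>j\<in>UNIV. u t $ j * (c j t + symplectic (w j t) (p t) / 2))) (at t within {0..T})"
        unfolding \<eta>_def
        by (intro has_vector_derivative_Pair z'[OF t]
            bounded_linear.has_vector_derivative[OF bounded_linear_fst p'[OF t]]
            bounded_linear.has_vector_derivative[OF bounded_linear_snd p'[OF t]])
      also have "(fst (\<Sum>j\<in>UNIV. u t $ j *\<^sub>R w j t), snd (\<Sum>j\<in>UNIV. u t $ j *\<^sub>R w j t),
            \<Sum>j\<in>UNIV. u t $ j * (c j t + symplectic (w j t) (p t) / 2))
          = (\<Sum>j\<in>UNIV. u t $ j *\<^sub>R (L (- t) (b j) + (1/2) *\<^sub>R brk (L (- t) (b j)) (\<eta> t)))"
        unfolding brk by (simp add: prod_eq_iff fst_sum snd_sum w_def c_def vert_def horiz_def)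
      finally show ?thesis .
    qed
    then have "trajectory X B u T (\<lambda>t. hexp (L t (\<eta> t)))"
      unfolding B by (rule trajectory_if_flow_coordinates[OF flow X X_cont u])
    then show "\<exists>u \<gamma>. admissible_input u \<and> trajectory X B u T \<gamma> \<and> \<gamma> 0 = g \<and> \<gamma> T = h"
      using admissible_input_if_continuous[OF u] \<eta>_ends
      by (intro exI[of _ u] exI[of _ "\<lambda>t. hexp (L t (\<eta> t))"]) (simp add: v0_def v1_def)
  qed
qed

end
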